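(* For any $H\in(0,1)$, $\alpha\in(0,1)$ and $b\in\{2,3,\dots\}$, the fractional Wiener--Weierstra\ss\ bridge $X$ with parameters $\alpha,b,H$ is not a semimartingale.
   Context: Let $W=(W(t))_{t\ge0}$ be a fractional Brownian motion with Hurst parameter $H\in(0,1)$. Let $\kappa:[0,1]\to[0,1]$ be a deterministic function with $\kappa(0)=0$, $\kappa(1)=1$ that is H\"older continuous with some exponent $\tau\in(H,1]$. The fractional Brownian bridge is $B(t):=W(t)-\kappa(t)W(1)$, $t\in[0,1]$. For $x\ge0$, $\{x\}$ denotes the fractional part of $x$. For $\alpha\in(0,1)$, $b\in\{2,3,\dots\}$, the fractional Wiener--Weierstra\ss\ bridge is $X(t):=\sum_{n=0}^\infty\alpha^nB(\{b^nt\})$, $0\le t\le1$. *)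

theory Defs
  imports "HOL-Probability.Probability"
begin

definition fbm_cov :: "real \<Rightarrow> real \<Rightarrow> real \<Rightarrow> real" where
  "fbm_cov H s t = (s powr (2*H) + t powr (2*H) - \<bar>t - s\<bar> powr (2*H)) / 2"

definition centered_normal :: "'a measure \<Rightarrow> ('a \<Rightarrow> real) \<Rightarrow> real \<Rightarrow> bool" where
  "centered_normal M Y v \<longleftrightarrow> Y \<in> borel_measurable M \<and>
     (if v = 0 then distr M borel Y = return borel 0
      else distributed M lborel Y (\<lambda>x. ennreal (normal_density 0 (sqrt v) x)))"

definition fbm :: "'a measure \<Rightarrow> real \<Rightarrow> (real \<Rightarrow> 'a \<Rightarrow> real) \<Rightarrow> bool" where
  "fbm M H W \<longleftrightarrow>
     (\<forall>t. W t \<in> borel_measurable M) \<and>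
     (\<forall>\<omega>\<in>space M. W 0 \<omega> = 0) \<and>
     (\<forall>\<omega>\<in>space M. continuous_on {0..} (\<lambda>t. W t \<omega>)) \<and>
     (\<forall>(n::nat) (t::nat \<Rightarrow> real) (c::nat \<Rightarrow> real). (\<forall>i<n. 0 \<le> t i) \<longrightarrow>
        centered_normal M (\<lambda>\<omega>. \<Sum>i<n. c i * W (t i) \<omega>)
          (\<Sum>i<n. \<Sum>j<n. c i * c j * fbm_cov H (t i) (t j)))"

definition fbridge :: "(real \<Rightarrow> 'a \<Rightarrow> real) \<Rightarrow> (real \<Rightarrow> real) \<Rightarrow> real \<Rightarrow> 'a \<Rightarrow> real" where
  "fbridge W \<kappa> t \<omega> = W t \<omega> - \<kappa> t * W 1 \<omega>"

definition wwbridge :: "(real \<Rightarrow> 'a \<Rightarrow> real) \<Rightarrow> (real \<Rightarrow> real) \<Rightarrow> real \<Rightarrow> nat \<Rightarrow> real \<Rightarrow> 'a \<Rightarrow> real" where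
  "wwbridge W \<kappa> \<alpha> b t \<omega> = (\<Sum>n. \<alpha> ^ n * fbridge W \<kappa> (frac (real b ^ n * t)) \<omega>)"

definition cadlag01 :: "(real \<Rightarrow> real) \<Rightarrow> bool" where
  "cadlag01 f \<longleftrightarrow> (\<forall>t\<in>{0..<1}. continuous (at_right t) f) \<and>
                   (\<forall>t\<in>{0<..1}. \<exists>l. (f \<longlongrightarrow> l) (at_left t))"

definition bounded_variation_on :: "(real \<Rightarrow> real) \<Rightarrow> real \<Rightarrow> real \<Rightarrow> bool" where
  "bounded_variation_on f a b \<longleftrightarrow> (\<exists>B. \<forall>ts::real list. sorted ts \<and> set ts \<subseteq> {a..b} \<longrightarrow>
      (\<Sum>i<length ts - 1. \<bar>f (ts ! Suc i) - f (ts ! i)\<bar>) \<le> B)"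

definition adapted01 :: "(real \<Rightarrow> 'a measure) \<Rightarrow> (real \<Rightarrow> 'a \<Rightarrow> real) \<Rightarrow> bool" where
  "adapted01 F Y \<longleftrightarrow> (\<forall>t\<in>{0..1}. Y t \<in> borel_measurable (F t))"

definition martingale01 :: "'a measure \<Rightarrow> (real \<Rightarrow> 'a measure) \<Rightarrow> (real \<Rightarrow> 'a \<Rightarrow> real) \<Rightarrow> bool" where
  "martingale01 M F Y \<longleftrightarrow> adapted01 F Y \<and> (\<forall>t\<in>{0..1}. integrable M (Y t)) \<and>
     (\<forall>s t. 0 \<le> s \<longrightarrow> s \<le> t \<longrightarrow> t \<le> 1 \<longrightarrow>
        (AE \<omega> in M. real_cond_exp M (F s) (Y t) \<omega> = Y s \<omega>))"

definition local_martingale01 :: "'a measure \<Rightarrow> (real \<Rightarrow> 'a measure) \<Rightarrow> (real \<Rightarrow> 'a \<Rightarrow> real) \<Rightarrow> bool" where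
  "local_martingale01 M F Y \<longleftrightarrow> adapted01 F Y \<and>
     (\<exists>\<tau> :: nat \<Rightarrow> 'a \<Rightarrow> real.
        (\<forall>n. stopping_time F (\<tau> n)) \<and>
        (\<forall>n. \<forall>\<omega>\<in>space M. 0 \<le> \<tau> n \<omega> \<and> \<tau> n \<omega> \<le> 1) \<and>
        (\<forall>n. \<forall>\<omega>\<in>space M. \<tau> n \<omega> \<le> \<tau> (Suc n) \<omega>) \<and>
        (AE \<omega> in M. \<exists>n. \<tau> n \<omega> = 1) \<and>
        (\<forall>n. martingale01 M F (\<lambda>t \<omega>. Y (min t (\<tau> n \<omega>)) \<omega>)))"

definition semimartingale01 :: "'a measure \<Rightarrow> (real \<Rightarrow> 'a measure) \<Rightarrow> (real \<Rightarrow> 'a \<Rightarrow> real) \<Rightarrow> bool" where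
  "semimartingale01 M F X \<longleftrightarrow> adapted01 F X \<and>
     (\<exists>L A :: real \<Rightarrow> 'a \<Rightarrow> real.
        local_martingale01 M F L \<and> adapted01 F A \<and>
        (\<forall>\<omega>\<in>space M. cadlag01 (\<lambda>t. L t \<omega>) \<and> cadlag01 (\<lambda>t. A t \<omega>)) \<and>
        (\<forall>\<omega>\<in>space M. L 0 \<omega> = 0 \<and> A 0 \<omega> = 0) \<and>
        (AE \<omega> in M. bounded_variation_on (\<lambda>t. A t \<omega>) 0 1) \<and>
        (AE \<omega> in M. \<forall>t\<in>{0..1}. X t \<omega> = X 0 \<omega> + L t \<omega> + A t \<omega>))"

definition filtration_of :: "'a measure \<Rightarrow> (real \<Rightarrow> 'a measure) \<Rightarrow> bool" where
  "filtration_of M F \<longleftrightarrow> filtration (space M) F \<and> (\<forall>t. sets (F t) \<subseteq> sets M)"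

end

theory Submission
  imports Defs
begin

text \<open>
  Elementary integrals of predictable integrands bounded by 1 against a semimartingale are bounded
  in probability: the finite variation part contributes at most its variation, and the localised
  martingale part is controlled by Burkholder's weak-type inequality for martingale transforms.

  The bridge violates this. Its values on \<open>[1/b, 2/b]\<close> repeat, up to the two finest levels of the
  series, its values on \<open>[0, 1/b]\<close>, so that past increments predict future ones. For increments
  \<open>V1, V2, V3, V4\<close> over intervals of length \<open>h\<close> starting at \<open>s\<close>, \<open>s + 1/b\<^sup>2\<close>, \<open>s + 1/b\<close>, \<open>s + 1/b + 1/b\<^sup>2\<close>
  the covariance of \<open>V1 - V2\<close> and \<open>V3 - V4\<close> is asymptotically \<open>2 * \<alpha>\<^sup>2 * (b * h) powr (2 * H)\<close>, since increments
  of the bridge \<open>B\<close> over small intervals with separated positions are nearly uncorrelated. Hence a past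
  increment \<open>V1\<close> or \<open>V2\<close> has correlation bounded away from 0 with a future one \<open>V3\<close> or \<open>V4\<close>. Integrating the
  signs of the past increments yields variables whose means grow like \<open>h powr (H - 1)\<close> and whose second
  moments are comparable to the squares of the means; by the Paley--Zygmund inequality they are not
  bounded in probability.
\<close>

text \<open>The obstacle is the size of the levels \<open>n \<ge> 2\<close>. Over a cell of length
  \<open>h\<close>, level \<open>n\<close> contributes up to the order of
  \<open>\<alpha> ^ n * (b ^ n * h) powr H\<close>, which can swamp the two finest levels if
  \<open>\<alpha> * b powr H > 1\<close>. No case distinction on \<open>\<alpha>\<close>,
  \<open>b\<close>, \<open>H\<close> is made and these levels are never estimated: they cancel
  exactly in \<open>V1 - V2\<close> and \<open>V3 - V4\<close>, and if they happen to be large, the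
  four increments are nearly equal and hence strongly correlated anyway. For the same reason signs
  are integrated, not the increments themselves: a sign is bounded whatever the size of the
  increment, and the mean of \<open>sgn U * V\<close> is, up to a constant, the covariance divided
  by the norm of \<open>U\<close>. Means and norms of the summands then scale alike, so the second
  moment of the whole sum needs only the triangle inequality and no decorrelation between summands.
  The cells fill the interval from \<open>1 / b ^ 4\<close> to \<open>2 / b ^ 4\<close>; this keeps
  the six places at which levels zero and one read the path of \<open>B\<close> apart.\<close>

section \<open>Burkholder's weak-type inequality\<close>

text \<open>This function dominates the indicator of \<open>\<bar>y\<bar> \<ge> 1\<close> minus \<open>2 * \<bar>x\<bar>\<close>, and it decreases in mean when
  \<open>x\<close> runs along a martingale and \<open>y\<close> along one of its transforms.\<close>

definition burkholder_fun :: "real \<Rightarrow> real \<Rightarrow> real" where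
  "burkholder_fun x y = (if \<bar>x\<bar> + \<bar>y\<bar> < 1 then y\<^sup>2 - x\<^sup>2 else 1 - 2 * \<bar>x\<bar>)"

text \<open>The derivative of \<open>burkholder_fun\<close> at \<open>(x, y)\<close> in the
  direction \<open>(1, h)\<close>. At the concave kink \<open>x = 0\<close> of the outer branch the
  value 0 is one of the admissible slopes.\<close>

definition burkholder_slope :: "real \<Rightarrow> real \<Rightarrow> real \<Rightarrow> real" where
  "burkholder_slope x y h = (if \<bar>x\<bar> + \<bar>y\<bar> < 1 then 2 * h * y - 2 * x else - 2 * sgn x)"

lemma burkholder_fun_le_outside: "burkholder_fun x y \<le> 1 - 2 * \<bar>x\<bar>"
proof (cases "\<bar>x\<bar> + \<bar>y\<bar> < 1")
  case True
  then have "\<bar>y\<bar>\<^sup>2 \<le> (1 - \<bar>x\<bar>)\<^sup>2"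
    by (intro power_mono) auto
  then show ?thesis
    using True by (simp add: burkholder_fun_def power2_diff)
qed (simp add: burkholder_fun_def)

lemma burkholder_fun_ge: "- 2 * \<bar>x\<bar> \<le> burkholder_fun x y"
proof (cases "\<bar>x\<bar> + \<bar>y\<bar> < 1")
  case True
  then have "\<bar>x\<bar> * \<bar>x\<bar> \<le> \<bar>x\<bar> * 1"
    by (intro mult_left_mono) auto
  moreover have "x\<^sup>2 = \<bar>x\<bar> * \<bar>x\<bar>" by (simp add: power2_eq_square)
  ultimately have "x\<^sup>2 \<le> 2 * \<bar>x\<bar>" using abs_ge_zero[of x] by linarith
  moreover have "0 \<le> y\<^sup>2" by simp
  ultimately have "- 2 * \<bar>x\<bar> \<le> y\<^sup>2 - x\<^sup>2" by linarith
  then show ?thesis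
    using True by (simp add: burkholder_fun_def)
qed (simp add: burkholder_fun_def)

lemma burkholder_fun_zero_right: "burkholder_fun x 0 \<le> 0"
  by (auto simp: burkholder_fun_def)

text \<open>A concavity property along directions \<open>(1, h)\<close> of slope at most 1. Inside
  the diamond the quadratic branch expands exactly, with remainder
  \<open>(h\<^sup>2 - 1) * a\<^sup>2 \<le> 0\<close>; outside, the concave function
  \<open>1 - 2 * \<bar>x\<bar>\<close> is a global majorant.\<close>

lemma burkholder_fun_step:
  fixes x y h a :: real
  assumes "\<bar>h\<bar> \<le> 1"
  shows "burkholder_fun (x + a) (y + h * a) \<le> burkholder_fun x y + burkholder_slope x y h * a"
proof (cases "\<bar>x\<bar> + \<bar>y\<bar> < 1")
  case inside: True
  define x' y' where "x' = x + a" and "y' = y + h * a"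
  have h: "h\<^sup>2 \<le> 1" using assms by (simp add: abs_square_le_1)
  then have h0: "0 \<le> (1 - h\<^sup>2) * a\<^sup>2" by simp
  have rhs: "burkholder_fun x y + burkholder_slope x y h * a = y'\<^sup>2 - x'\<^sup>2 + (1 - h\<^sup>2) * a\<^sup>2"
    using inside by (simp add: burkholder_fun_def burkholder_slope_def x'_def y'_def power2_eq_square algebra_simps)
  have "burkholder_fun x' y' \<le> y'\<^sup>2 - x'\<^sup>2 + (1 - h\<^sup>2) * a\<^sup>2"
  proof (cases "\<bar>x'\<bar> + \<bar>y'\<bar> < 1")
    case True
    then show ?thesis using h0 by (simp add: burkholder_fun_def)
  next
    case out: False
    \<comment> \<open>Completing the square turns the claim for the outer branch into this
      inequality. If \<open>\<bar>x'\<bar> > 1\<close>, the jump must have crossed the diamond,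
      whence \<open>\<bar>x'\<bar> - 1 \<le> \<bar>a\<bar> - \<bar>y\<bar>\<close>.\<close>
    have "(1 - \<bar>x'\<bar>)\<^sup>2 \<le> y'\<^sup>2 + (1 - h\<^sup>2) * a\<^sup>2"
    proof (cases "\<bar>x'\<bar> \<le> 1")
      case True
      then have "(1 - \<bar>x'\<bar>)\<^sup>2 \<le> \<bar>y'\<bar>\<^sup>2" using out by (intro power_mono) auto
      then show ?thesis using h0 by simp
    next
      case False
      have "\<bar>x'\<bar> \<le> \<bar>x\<bar> + \<bar>a\<bar>" unfolding x'_def by (rule abs_triangle_ineq)
      then have "(\<bar>x'\<bar> - 1)\<^sup>2 \<le> (\<bar>a\<bar> - \<bar>y\<bar>)\<^sup>2"
        using False inside by (intro power_mono) auto
      also have "\<dots> = y\<^sup>2 - 2 * (\<bar>a\<bar> * \<bar>y\<bar>) + a\<^sup>2" by (simp add: power2_diff)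
      also have "\<dots> \<le> y\<^sup>2 + 2 * (h * a * y) + a\<^sup>2"
      proof -
        have "\<bar>h * a * y\<bar> \<le> 1 * (\<bar>a\<bar> * \<bar>y\<bar>)"
          unfolding abs_mult mult.assoc by (rule mult_right_mono) (use assms in auto)
        then show ?thesis by linarith
      qed
      also have "\<dots> = y'\<^sup>2 + (1 - h\<^sup>2) * a\<^sup>2"
        by (simp add: y'_def power2_eq_square algebra_simps)
      finally show ?thesis by (simp add: power2_commute)
    qed
    then show ?thesis using out by (simp add: burkholder_fun_def power2_diff)
  qed
  then show ?thesis unfolding rhs x'_def y'_def .
next
  case False
  have "\<bar>x\<bar> + sgn x * a \<le> \<bar>x + a\<bar>"
    by (auto simp: sgn_if)
  then show ?thesis
    using burkholder_fun_le_outside[of "x + a" "y + h * a"] False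
    by (simp add: burkholder_fun_def burkholder_slope_def)
qed

lemma abs_burkholder_fun_le: "\<bar>burkholder_fun x y\<bar> \<le> 1 + 2 * \<bar>x\<bar>"
  using burkholder_fun_le_outside[of x y] burkholder_fun_ge[of x y] by linarith

lemma abs_burkholder_slope_le: "\<bar>h\<bar> \<le> 1 \<Longrightarrow> \<bar>burkholder_slope x y h\<bar> \<le> 2"
proof -
  assume h: "\<bar>h\<bar> \<le> 1"
  have "\<bar>h * y\<bar> \<le> 1 * \<bar>y\<bar>" unfolding abs_mult by (rule mult_right_mono) (use h in auto)
  then show ?thesis by (auto simp: burkholder_slope_def sgn_if)
qed

lemma burkholder_fun_measurable [measurable (raw)]:
  assumes [measurable]: "f \<in> borel_measurable N" "g \<in> borel_measurable N"
  shows "(\<lambda>\<omega>. burkholder_fun (f \<omega>) (g \<omega>)) \<in> borel_measurable N"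
  unfolding burkholder_fun_def by measurable

lemma burkholder_slope_measurable [measurable (raw)]:
  assumes [measurable]: "f \<in> borel_measurable N" "g \<in> borel_measurable N" "k \<in> borel_measurable N"
  shows "(\<lambda>\<omega>. burkholder_slope (f \<omega>) (g \<omega>) (k \<omega>)) \<in> borel_measurable N"
  unfolding burkholder_slope_def by measurable

text \<open>The bounded factor can be pulled out of the conditional expectation. This removes the
  linear term of \<open>burkholder_fun_step\<close> in mean.\<close>

lemma (in prob_space) martingale_increment_orthogonal:
  fixes f Y Z :: "'a \<Rightarrow> real"
  assumes sub: "subalgebra M G"
    and f: "f \<in> borel_measurable G" "\<And>\<omega>. \<omega> \<in> space M \<Longrightarrow> \<bar>f \<omega>\<bar> \<le> c"
    and Y: "integrable M Y" and Z: "integrable M Z"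
    and AE_eq: "AE \<omega> in M. real_cond_exp M G Z \<omega> = Y \<omega>"
  shows "integrable M (\<lambda>\<omega>. f \<omega> * (Z \<omega> - Y \<omega>))" "(\<integral>\<omega>. f \<omega> * (Z \<omega> - Y \<omega>) \<partial>M) = 0"
proof -
  interpret finite_measure_subalgebra M G
    by unfold_locales (rule sub)
  have [measurable]: "f \<in> borel_measurable M"
    by (rule measurable_from_subalg[OF sub f(1)])
  have int: "integrable M (\<lambda>\<omega>. f \<omega> * V \<omega>)" if "integrable M V" for V :: "'a \<Rightarrow> real"
    by (rule Bochner_Integration.integrable_bound[where f="\<lambda>\<omega>. c * V \<omega>"])
       (use that f(2) in \<open>auto intro!: AE_I2 simp: abs_mult intro!: mult_right_mono order_trans[OF f(2)]\<close>)
  show "integrable M (\<lambda>\<omega>. f \<omega> * (Z \<omega> - Y \<omega>))" using int[of "\<lambda>\<omega>. Z \<omega> - Y \<omega>"] Y Z by auto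
  have "(\<integral>\<omega>. f \<omega> * Z \<omega> \<partial>M) = (\<integral>\<omega>. f \<omega> * real_cond_exp M G Z \<omega> \<partial>M)"
    using real_cond_exp_intg(2)[of f Z] int[OF Z] f(1) Z by auto
  also have "\<dots> = (\<integral>\<omega>. f \<omega> * Y \<omega> \<partial>M)"
    using AE_eq Y by (intro integral_cong_AE) auto
  finally show "(\<integral>\<omega>. f \<omega> * (Z \<omega> - Y \<omega>) \<partial>M) = 0"
    using int[OF Y] int[OF Z] by (simp add: right_diff_distrib)
qed

text \<open>After division by \<open>K\<close>, the mean of \<open>burkholder_fun\<close> starts
  nonpositive because the transform starts at 0, and never increases. At the end it dominates the
  indicator of the event minus \<open>2 * \<bar>x m \<omega>\<bar>\<close>, which is where the
  constant 2 comes from.\<close>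

lemma (in prob_space) martingale_transform_weak_type:
  fixes Y G :: "nat \<Rightarrow> 'a \<Rightarrow> real" and F :: "nat \<Rightarrow> 'a measure"
  assumes sub: "\<And>q. q \<le> m \<Longrightarrow> subalgebra M (F q)"
    and mono: "\<And>p q. p \<le> q \<Longrightarrow> q \<le> m \<Longrightarrow> sets (F p) \<subseteq> sets (F q)"
    and Y: "\<And>q. q \<le> m \<Longrightarrow> Y q \<in> borel_measurable (F q)" "\<And>q. q \<le> m \<Longrightarrow> integrable M (Y q)"
    and mart: "\<And>q. q < m \<Longrightarrow> AE \<omega> in M. real_cond_exp M (F q) (Y (Suc q)) \<omega> = Y q \<omega>"
    and G: "\<And>q. q < m \<Longrightarrow> G q \<in> borel_measurable (F q)"
      "\<And>q \<omega>. q < m \<Longrightarrow> \<omega> \<in> space M \<Longrightarrow> \<bar>G q \<omega>\<bar> \<le> 1"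
    and K: "0 < K"
  shows "prob {\<omega> \<in> space M. K \<le> \<bar>\<Sum>q<m. G q \<omega> * (Y (Suc q) \<omega> - Y q \<omega>)\<bar>} \<le> 2 * expectation (\<lambda>\<omega>. \<bar>Y m \<omega>\<bar>) / K"
proof -
  define x where "x q \<omega> = Y q \<omega> / K" for q \<omega>
  define y where "y q \<omega> = (\<Sum>p<q. G p \<omega> * (Y (Suc p) \<omega> - Y p \<omega>)) / K" for q \<omega>
  have subF: "subalgebra (F q) (F p)" if "p \<le> q" "q \<le> m" for p q
    using sub[of p] sub[of q] mono[of p q] that by (auto simp: subalgebra_def)
  have YF: "Y p \<in> borel_measurable (F q)" if "p \<le> q" "q \<le> m" for p q
    by (rule measurable_from_subalg[OF subF[OF that]]) (use Y(1) that in auto)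
  have GF: "G p \<in> borel_measurable (F q)" if "p \<le> q" "q \<le> m" "p < m" for p q
    by (rule measurable_from_subalg[OF subF[OF that(1,2)]]) (use G(1) that in auto)
  have xF: "x q \<in> borel_measurable (F q)" if "q \<le> m" for q
    unfolding x_def[abs_def] using Y(1)[OF that] by measurable
  have yF: "y q \<in> borel_measurable (F q)" if "q \<le> m" for q
    unfolding y_def[abs_def]
    by (intro borel_measurable_divide borel_measurable_sum borel_measurable_times borel_measurable_diff)
       (use that in \<open>auto intro!: YF GF\<close>)
  have [measurable]: "x q \<in> borel_measurable M" "y q \<in> borel_measurable M" if "q \<le> m" for q
    using measurable_from_subalg[OF sub[OF that] xF[OF that]] measurable_from_subalg[OF sub[OF that] yF[OF that]]
    by auto
  have xint: "integrable M (x q)" if "q \<le> m" for q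
    unfolding x_def[abs_def] using Y(2)[OF that] by auto
  have Uint: "integrable M (\<lambda>\<omega>. burkholder_fun (x q \<omega>) (y q \<omega>))" if "q \<le> m" for q
    by (rule Bochner_Integration.integrable_bound[where f="\<lambda>\<omega>. 1 + 2 * \<bar>x q \<omega>\<bar>"])
       (use that xint[OF that] abs_burkholder_fun_le in \<open>auto intro!: AE_I2 order_trans[OF abs_burkholder_fun_le]\<close>)
  have le0: "(\<integral>\<omega>. burkholder_fun (x q \<omega>) (y q \<omega>) \<partial>M) \<le> 0" if "q \<le> m" for q
    using that
  proof (induction q)
    case 0
    have "y 0 = (\<lambda>\<omega>. 0)" by (auto simp: y_def)
    then show ?case
      using Bochner_Integration.integral_nonneg[where M=M and f="\<lambda>\<omega>. - burkholder_fun (x 0 \<omega>) 0"] burkholder_fun_zero_right by simp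
  next
    case (Suc q)
    then have q: "q \<le> m" "q < m" by auto
    have slopeF: "(\<lambda>\<omega>. burkholder_slope (x q \<omega>) (y q \<omega>) (G q \<omega>)) \<in> borel_measurable (F q)"
      using xF[OF q(1)] yF[OF q(1)] G(1)[OF q(2)] by measurable
    let ?s = "\<lambda>\<omega>. burkholder_slope (x q \<omega>) (y q \<omega>) (G q \<omega>) * (Y (Suc q) \<omega> - Y q \<omega>)"
    have orth: "integrable M ?s" "(\<integral>\<omega>. ?s \<omega> \<partial>M) = 0"
      using martingale_increment_orthogonal[OF sub[OF q(1)] slopeF _ Y(2)[OF q(1)] Y(2)[OF Suc.prems] mart[OF q(2)], of 2]
        abs_burkholder_slope_le[OF G(2)[OF q(2)]] by auto
    have "(\<integral>\<omega>. burkholder_fun (x (Suc q) \<omega>) (y (Suc q) \<omega>) \<partial>M)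
        \<le> (\<integral>\<omega>. burkholder_fun (x q \<omega>) (y q \<omega>) + ?s \<omega> / K \<partial>M)"
    proof (rule integral_mono)
      fix \<omega> assume "\<omega> \<in> space M"
      have "x (Suc q) \<omega> = x q \<omega> + (Y (Suc q) \<omega> - Y q \<omega>) / K"
        "y (Suc q) \<omega> = y q \<omega> + G q \<omega> * ((Y (Suc q) \<omega> - Y q \<omega>) / K)"
        using K by (auto simp: x_def y_def field_simps)
      then show "burkholder_fun (x (Suc q) \<omega>) (y (Suc q) \<omega>) \<le> burkholder_fun (x q \<omega>) (y q \<omega>) + ?s \<omega> / K"
        using burkholder_fun_step[OF G(2)[OF q(2) \<open>\<omega> \<in> space M\<close>], of "x q \<omega>" "(Y (Suc q) \<omega> - Y q \<omega>) / K" "y q \<omega>"]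
        by simp
    qed (use Uint[OF q(1)] Uint[OF Suc.prems] orth(1) in auto)
    also have "\<dots> = (\<integral>\<omega>. burkholder_fun (x q \<omega>) (y q \<omega>) \<partial>M)"
      using Uint[OF q(1)] orth by simp
    also have "\<dots> \<le> 0" using Suc by simp
    finally show ?case .
  qed
  let ?E = "{\<omega> \<in> space M. K \<le> \<bar>\<Sum>q<m. G q \<omega> * (Y (Suc q) \<omega> - Y q \<omega>)\<bar>}"
  have E: "?E = {\<omega> \<in> space M. 1 \<le> \<bar>y m \<omega>\<bar>}"
    using K by (auto simp: y_def field_simps)
  have [measurable]: "?E \<in> sets M" unfolding E by measurable
  have "prob ?E = (\<integral>\<omega>. indicator ?E \<omega> \<partial>M)" by simp
  also have "\<dots> \<le> (\<integral>\<omega>. burkholder_fun (x m \<omega>) (y m \<omega>) + 2 * \<bar>x m \<omega>\<bar> \<partial>M)"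
  proof (rule integral_mono)
    fix \<omega> assume "\<omega> \<in> space M"
    show "indicator ?E \<omega> \<le> burkholder_fun (x m \<omega>) (y m \<omega>) + 2 * \<bar>x m \<omega>\<bar>"
      unfolding E using burkholder_fun_ge[of "x m \<omega>" "y m \<omega>"]
      by (auto simp: indicator_def burkholder_fun_def)
  qed (use Uint[of m] xint[of m] in \<open>auto simp: emeasure_eq_measure\<close>)
  also have "\<dots> \<le> 2 * (\<integral>\<omega>. \<bar>x m \<omega>\<bar> \<partial>M)"
    using Uint[of m] xint[of m] le0[of m] by simp
  also have "\<dots> = 2 * expectation (\<lambda>\<omega>. \<bar>Y m \<omega>\<bar>) / K"
    using K by (simp add: x_def)
  finally show ?thesis .
qed

section \<open>Elementary integrals against a semimartingale\<close>

text \<open>Turns a bound that holds on almost every path with a random index into one with a fixed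
  index, outside an event of small probability. It serves the localising times and the
  variation.\<close>

lemma (in prob_space) decseq_null_small_prob:
  fixes E :: "nat \<Rightarrow> 'a set"
  assumes E: "\<And>n. E n \<in> events" "decseq E" and null: "AE \<omega> in M. \<exists>n. \<omega> \<notin> E n" and "0 < \<epsilon>"
  obtains n where "prob (E n) < \<epsilon>"
proof -
  have "(\<lambda>n. prob (E n)) \<longlonglongrightarrow> prob (\<Inter>n. E n)"
    using E by (intro finite_Lim_measure_decseq) auto
  moreover have "prob (\<Inter>n. E n) = 0"
    using null E(1) by (intro prob_eq_0[THEN iffD2]) auto
  ultimately have "eventually (\<lambda>n. prob (E n) < \<epsilon>) sequentially"
    using \<open>0 < \<epsilon>\<close> by (auto dest: order_tendstoD(2))
  then show ?thesis
    using that by (auto simp: eventually_sequentially)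
qed

lemma grid_variation_le:
  assumes B: "\<forall>ts::real list. sorted ts \<and> set ts \<subseteq> {0..1} \<longrightarrow>
      (\<Sum>i<length ts - 1. \<bar>f (ts ! Suc i) - f (ts ! i)\<bar>) \<le> B" and "0 < n"
  shows "(\<Sum>q<n. \<bar>f (real (Suc q) / real n) - f (real q / real n)\<bar>) \<le> B"
proof -
  let ?ts = "map (\<lambda>q. real q / real n) [0..<Suc n]"
  have "sorted ?ts"
    by (auto simp: sorted_iff_nth_mono divide_right_mono simp del: upt_Suc)
  moreover have "set ?ts \<subseteq> {0..1}"
    using \<open>0 < n\<close> by (auto simp del: upt_Suc)
  ultimately have "(\<Sum>i<length ?ts - 1. \<bar>f (?ts ! Suc i) - f (?ts ! i)\<bar>) \<le> B"
    using B by blast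
  also have "(\<Sum>i<length ?ts - 1. \<bar>f (?ts ! Suc i) - f (?ts ! i)\<bar>)
      = (\<Sum>q<n. \<bar>f (real (Suc q) / real n) - f (real q / real n)\<bar>)"
    by (rule sum.cong) (auto simp del: upt_Suc)
  finally show ?thesis .
qed

text \<open>Three exceptional events get probability at most \<open>\<epsilon> / 3\<close> each: the
  localising time stays below 1, the variation exceeds \<open>k\<close>, or the transform of the
  stopped martingale reaches \<open>K1\<close>. All three bounds are uniform in the grid and the
  integrand.\<close>

lemma (in prob_space) semimartingale_integrals_bounded_in_prob:
  fixes X :: "real \<Rightarrow> 'a \<Rightarrow> real" and F :: "real \<Rightarrow> 'a measure"
  assumes F: "filtration_of M F" and X: "semimartingale01 M F X" and "0 < \<epsilon>"
  obtains K where "0 < K"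
    "\<And>n G. 0 < n \<Longrightarrow> (\<And>q. q < n \<Longrightarrow> G q \<in> borel_measurable (F (real q / real n))) \<Longrightarrow>
       (\<And>q \<omega>. q < n \<Longrightarrow> \<omega> \<in> space M \<Longrightarrow> \<bar>G q \<omega>\<bar> \<le> 1) \<Longrightarrow>
       prob {\<omega> \<in> space M. K \<le> \<bar>\<Sum>q<n. G q \<omega> * (X (real (Suc q) / real n) \<omega> - X (real q / real n) \<omega>)\<bar>} \<le> \<epsilon>"
proof -
  have spF: "space (F t) = space M" and setsF: "sets (F t) \<subseteq> sets M" for t
    using F by (auto simp: filtration_of_def filtration_def)
  have monoF: "sets (F s) \<subseteq> sets (F t)" if "s \<le> t" for s t
    using F that by (auto simp: filtration_of_def filtration_def)
  have sub: "subalgebra M (F t)" for t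
    using spF setsF by (auto simp: subalgebra_def)
  have toM: "f \<in> borel_measurable M" if "f \<in> borel_measurable (F t)" for f :: "'a \<Rightarrow> real" and t
    using measurable_from_subalg[OF sub that] .
  obtain L A where L: "local_martingale01 M F L" and A: "adapted01 F A"
    and bv: "AE \<omega> in M. bounded_variation_on (\<lambda>t. A t \<omega>) 0 1"
    and XLA: "AE \<omega> in M. \<forall>t\<in>{0..1}. X t \<omega> = X 0 \<omega> + L t \<omega> + A t \<omega>"
    using X unfolding semimartingale01_def by blast
  have XM: "X t \<in> borel_measurable M" and AM: "A t \<in> borel_measurable M" if "t \<in> {0..1}" for t
    using X A that toM unfolding semimartingale01_def adapted01_def by blast+
  obtain \<tau> :: "nat \<Rightarrow> 'a \<Rightarrow> real" where
    st: "\<And>j. stopping_time F (\<tau> j)"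
    and t01: "\<And>j \<omega>. \<omega> \<in> space M \<Longrightarrow> 0 \<le> \<tau> j \<omega> \<and> \<tau> j \<omega> \<le> 1"
    and tmono: "\<And>j \<omega>. \<omega> \<in> space M \<Longrightarrow> \<tau> j \<omega> \<le> \<tau> (Suc j) \<omega>"
    and tAE: "AE \<omega> in M. \<exists>j. \<tau> j \<omega> = 1"
    and tmart: "\<And>j. martingale01 M F (\<lambda>t \<omega>. L (min t (\<tau> j \<omega>)) \<omega>)"
    using L unfolding local_martingale01_def by blast
  have \<tau>meas[measurable]: "\<tau> j \<in> borel_measurable M" for j
  proof (rule borel_measurableI_le)
    fix y
    have "Measurable.pred (F y) (\<lambda>\<omega>. \<tau> j \<omega> \<le> y)" using st[of j] by (auto simp: stopping_time_def)
    then have "{\<omega> \<in> space M. \<tau> j \<omega> \<le> y} \<in> sets (F y)" by (simp add: pred_def spF)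
    then show "{\<omega> \<in> space M. \<tau> j \<omega> \<le> y} \<in> sets M" using setsF by auto
  qed
  have "decseq (\<lambda>j. {\<omega> \<in> space M. \<tau> j \<omega> < 1})"
    by (rule decseq_SucI) (use tmono in \<open>auto intro: le_less_trans\<close>)
  moreover have "AE \<omega> in M. \<exists>j. \<omega> \<notin> {\<omega> \<in> space M. \<tau> j \<omega> < 1}"
    using tAE by eventually_elim (metis (mono_tags, lifting) less_irrefl mem_Collect_eq)
  ultimately obtain j where j: "prob {\<omega> \<in> space M. \<tau> j \<omega> < 1} < \<epsilon> / 3"
    using decseq_null_small_prob[of "\<lambda>j. {\<omega> \<in> space M. \<tau> j \<omega> < 1}" "\<epsilon> / 3"] \<open>0 < \<epsilon>\<close> by auto
  define Y where "Y t \<omega> = L (min t (\<tau> j \<omega>)) \<omega>" for t \<omega>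
  have Y: "martingale01 M F Y" unfolding Y_def by (rule tmart)
  define V where "V n \<omega> = (\<Sum>q<n. \<bar>A (real (Suc q) / real n) \<omega> - A (real q / real n) \<omega>\<bar>)" for n \<omega>
  have [measurable]: "V n \<in> borel_measurable M" for n
    unfolding V_def[abs_def] by (intro borel_measurable_sum borel_measurable_abs borel_measurable_diff AM) auto
  \<comment> \<open>Only the equidistant grids enter, so that the event is a countable union and
    measurable.\<close>
  define E where "E k = {\<omega> \<in> space M. \<exists>n>0. real k < V n \<omega>}" for k
  have Em[measurable]: "E k \<in> sets M" for k unfolding E_def by measurable
  have "decseq E"
    by (rule decseq_SucI) (auto simp: E_def)
  moreover have "AE \<omega> in M. \<exists>k. \<omega> \<notin> E k"
    using bv
  proof eventually_elim
    case (elim \<omega>)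
    then obtain B where B: "\<forall>ts::real list. sorted ts \<and> set ts \<subseteq> {0..1} \<longrightarrow>
      (\<Sum>i<length ts - 1. \<bar>A (ts ! Suc i) \<omega> - A (ts ! i) \<omega>\<bar>) \<le> B"
      unfolding bounded_variation_on_def by blast
    obtain k :: nat where "B \<le> real k" using real_arch_simple by blast
    then have "V n \<omega> \<le> real k" if "0 < n" for n
      using grid_variation_le[OF B that] unfolding V_def by linarith
    then have "\<omega> \<notin> E k" by (auto simp: E_def not_less)
    then show ?case ..
  qed
  ultimately obtain k where k: "prob (E k) < \<epsilon> / 3"
    using decseq_null_small_prob[of E "\<epsilon> / 3"] Em \<open>0 < \<epsilon>\<close> by auto
  let ?e = "expectation (\<lambda>\<omega>. \<bar>Y 1 \<omega>\<bar>)"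
  \<comment> \<open>The sum of \<open>K1\<close> and \<open>real k\<close>. The term
    \<open>6 * ?e / \<epsilon>\<close> makes the weak-type bound \<open>2 * ?e / K1\<close> at most
    \<open>\<epsilon> / 3\<close>; the summand 1 keeps \<open>K1\<close> positive when
    \<open>?e = 0\<close>.\<close>
  define K where "K = 6 * ?e / \<epsilon> + real k + 1"
  have e0: "0 \<le> ?e" by (intro Bochner_Integration.integral_nonneg) auto
  then have e1: "0 \<le> 6 * ?e / \<epsilon>" using \<open>0 < \<epsilon>\<close> by auto
  define K1 where "K1 = 6 * ?e / \<epsilon> + 1"
  have K1: "0 < K1" "2 * ?e / K1 \<le> \<epsilon> / 3"
  proof -
    show pos: "0 < K1" using e1 by (simp add: K1_def)
    have "6 * ?e = (K1 - 1) * \<epsilon>" using \<open>0 < \<epsilon>\<close> by (simp add: K1_def)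
    also have "\<dots> \<le> K1 * \<epsilon>" using \<open>0 < \<epsilon>\<close> by (simp add: left_diff_distrib)
    finally show "2 * ?e / K1 \<le> \<epsilon> / 3" using pos by (simp add: field_simps)
  qed
  show ?thesis
  proof (rule that[of K])
    show "0 < K" using e1 by (simp add: K_def)
    fix n :: nat and G :: "nat \<Rightarrow> 'a \<Rightarrow> real"
    assume n: "0 < n" and G: "\<And>q. q < n \<Longrightarrow> G q \<in> borel_measurable (F (real q / real n))"
      and G1: "\<And>q \<omega>. q < n \<Longrightarrow> \<omega> \<in> space M \<Longrightarrow> \<bar>G q \<omega>\<bar> \<le> 1"
    define t where "t q = real q / real n" for q
    have tin: "t q \<in> {0..1}" if "q \<le> n" for q using that n by (auto simp: t_def)
    have tle: "t p \<le> t q" if "p \<le> q" for p q using that by (auto simp: t_def divide_right_mono)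
    have GM[measurable]: "G q \<in> borel_measurable M" if "q < n" for q using toM[OF G[OF that]] .
    have YF: "Y (t q) \<in> borel_measurable (F (t q))" "integrable M (Y (t q))" if "q \<le> n" for q
      using Y tin[OF that] unfolding martingale01_def adapted01_def by auto
    have Ymart: "AE \<omega> in M. real_cond_exp M (F (t q)) (Y (t (Suc q))) \<omega> = Y (t q) \<omega>" if "q < n" for q
    proof -
      have "0 \<le> t q" "t q \<le> t (Suc q)" "t (Suc q) \<le> 1"
        using that tin[of q] tin[of "Suc q"] tle[of q "Suc q"] by auto
      then show ?thesis using Y unfolding martingale01_def by blast
    qed
    have tn: "t n = 1" using n by (simp add: t_def)
    let ?S = "\<lambda>\<omega>. \<Sum>q<n. G q \<omega> * (X (t (Suc q)) \<omega> - X (t q) \<omega>)"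
    let ?T = "\<lambda>\<omega>. \<Sum>q<n. G q \<omega> * (Y (t (Suc q)) \<omega> - Y (t q) \<omega>)"
    let ?D = "{\<omega> \<in> space M. K1 \<le> \<bar>?T \<omega>\<bar>}"
    have [measurable]: "?T \<in> borel_measurable M" 
      by (intro borel_measurable_sum borel_measurable_times borel_measurable_diff)
         (use YF(2) GM in auto)
    have [measurable]: "?S \<in> borel_measurable M" 
      by (intro borel_measurable_sum borel_measurable_times borel_measurable_diff XM)
         (use GM tin in auto)
    have D: "prob ?D \<le> 2 * ?e / K1"
      unfolding tn[symmetric]
    proof (rule martingale_transform_weak_type[where F="\<lambda>q. F (t q)"])
      show "sets (F (t p)) \<subseteq> sets (F (t q))" if "p \<le> q" for p q
        by (rule monoF[OF tle[OF that]])
      show "G q \<in> borel_measurable (F (t q))" if "q < n" for q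
        using G[OF that] by (simp add: t_def)
    qed (use sub YF Ymart G1 K1(1) in auto)
    have "prob {\<omega> \<in> space M. K \<le> \<bar>?S \<omega>\<bar>} \<le> prob ({\<omega> \<in> space M. \<tau> j \<omega> < 1} \<union> E k \<union> ?D)"
    proof (rule finite_measure_mono_AE)
      show "AE \<omega> in M. \<omega> \<in> {\<omega> \<in> space M. K \<le> \<bar>?S \<omega>\<bar>} \<longrightarrow> \<omega> \<in> {\<omega> \<in> space M. \<tau> j \<omega> < 1} \<union> E k \<union> ?D"
        using XLA AE_space
      proof eventually_elim
        case (elim \<omega>)
        show ?case
        proof (rule impI, rule ccontr)
          assume S: "\<omega> \<in> {\<omega> \<in> space M. K \<le> \<bar>?S \<omega>\<bar>}"
            and "\<omega> \<notin> {\<omega> \<in> space M. \<tau> j \<omega> < 1} \<union> E k \<union> ?D"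
          then have "\<not> \<tau> j \<omega> < 1" and nE': "\<forall>n. n = 0 \<or> V n \<omega> \<le> real k" and nD: "\<bar>?T \<omega>\<bar> < K1"
            by (auto simp: E_def not_less not_le)
          have nE: "V n \<omega> \<le> real k" using spec[OF nE', of n] n by linarith
          have nt: "\<tau> j \<omega> = 1" using t01[OF elim(2), of j] \<open>\<not> \<tau> j \<omega> < 1\<close> by auto
          have YL: "Y (t q) \<omega> = L (t q) \<omega>" if "q \<le> n" for q
            using tin[OF that] nt by (simp add: Y_def min_absorb1)
          have "?S \<omega> = (\<Sum>q<n. G q \<omega> * (Y (t (Suc q)) \<omega> - Y (t q) \<omega>) + G q \<omega> * (A (t (Suc q)) \<omega> - A (t q) \<omega>))"
          proof (rule sum.cong)
            fix q assume "q \<in> {..<n}"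
            then have q: "q \<le> n" "Suc q \<le> n" by auto
            have "X (t (Suc q)) \<omega> = X 0 \<omega> + Y (t (Suc q)) \<omega> + A (t (Suc q)) \<omega>"
              "X (t q) \<omega> = X 0 \<omega> + Y (t q) \<omega> + A (t q) \<omega>"
              unfolding YL[OF q(1)] YL[OF q(2)]
              using elim(1)[rule_format, OF tin[OF q(2)]] elim(1)[rule_format, OF tin[OF q(1)]] by simp_all
            then show "G q \<omega> * (X (t (Suc q)) \<omega> - X (t q) \<omega>) = G q \<omega> * (Y (t (Suc q)) \<omega> - Y (t q) \<omega>) + G q \<omega> * (A (t (Suc q)) \<omega> - A (t q) \<omega>)"
              by (simp add: algebra_simps)
          qed simp
          also have "\<dots> = ?T \<omega> + (\<Sum>q<n. G q \<omega> * (A (t (Suc q)) \<omega> - A (t q) \<omega>))"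
            by (rule sum.distrib)
          finally have "\<bar>?S \<omega>\<bar> \<le> \<bar>?T \<omega>\<bar> + \<bar>\<Sum>q<n. G q \<omega> * (A (t (Suc q)) \<omega> - A (t q) \<omega>)\<bar>" by linarith
          moreover have "\<bar>\<Sum>q<n. G q \<omega> * (A (t (Suc q)) \<omega> - A (t q) \<omega>)\<bar> \<le> V n \<omega>"
            unfolding V_def t_def[symmetric]
          proof (rule order_trans[OF sum_abs], rule sum_mono)
            fix q assume "q \<in> {..<n}"
            then have "\<bar>G q \<omega>\<bar> * \<bar>A (t (Suc q)) \<omega> - A (t q) \<omega>\<bar> \<le> 1 * \<bar>A (t (Suc q)) \<omega> - A (t q) \<omega>\<bar>"
              using G1 S by (intro mult_right_mono) auto
            then show "\<bar>G q \<omega> * (A (t (Suc q)) \<omega> - A (t q) \<omega>)\<bar> \<le> \<bar>A (t (Suc q)) \<omega> - A (t q) \<omega>\<bar>"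
              by (simp add: abs_mult)
          qed
          ultimately have "\<bar>?S \<omega>\<bar> < K" using nE nD by (simp add: K_def K1_def)
          with S show False by auto
        qed
      qed
      show "{\<omega> \<in> space M. \<tau> j \<omega> < 1} \<union> E k \<union> ?D \<in> events" by measurable
    qed
    also have "\<dots> \<le> prob {\<omega> \<in> space M. \<tau> j \<omega> < 1} + prob (E k) + prob ?D"
      by (intro order_trans[OF measure_Un_le] add_mono order_refl) (auto intro!: measure_Un_le)
    also have "\<dots> \<le> \<epsilon>" using j k D K1(2) by linarith
    finally show "prob {\<omega> \<in> space M. K \<le> \<bar>\<Sum>q<n. G q \<omega> * (X (real (Suc q) / real n) \<omega> - X (real q / real n) \<omega>)\<bar>} \<le> \<epsilon>"
      by (simp add: t_def)
  qed
qed

section \<open>Square-integrable random variables and Gaussian moments\<close>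

text \<open>For \<open>v < 0\<close> the predicate still describes a normal law, of variance \<open>- v\<close>, because the density only
  involves the square of \<open>sqrt v\<close>; hence the absolute values.\<close>

lemma (in prob_space) centered_normal_moments:
  assumes "centered_normal M Y v"
  shows "Y \<in> borel_measurable M" "integrable M (\<lambda>\<omega>. (Y \<omega>)\<^sup>2)" "expectation (\<lambda>\<omega>. (Y \<omega>)\<^sup>2) = \<bar>v\<bar>"
    "expectation (\<lambda>\<omega>. \<bar>Y \<omega>\<bar>) = sqrt (2 / pi) * sqrt \<bar>v\<bar>"
proof -
  show Y[measurable]: "Y \<in> borel_measurable M" using assms by (simp add: centered_normal_def)
  have "integrable M (\<lambda>\<omega>. (Y \<omega>)\<^sup>2) \<and> expectation (\<lambda>\<omega>. (Y \<omega>)\<^sup>2) = \<bar>v\<bar> \<and>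
    expectation (\<lambda>\<omega>. \<bar>Y \<omega>\<bar>) = sqrt (2 / pi) * sqrt \<bar>v\<bar>"
  proof (cases "v = 0")
    case True
    then have d: "distr M borel Y = return borel 0" using assms by (simp add: centered_normal_def)
    have "AE x in distr M borel Y. x = 0" unfolding d by (simp add: AE_return)
    then have z: "AE \<omega> in M. Y \<omega> = 0" by (simp add: AE_distr_iff)
    have z2: "AE \<omega> in M. (Y \<omega>)\<^sup>2 = 0" "AE \<omega> in M. \<bar>Y \<omega>\<bar> = 0" using z by auto
    have "integrable M (\<lambda>\<omega>. (Y \<omega>)\<^sup>2)"
      by (subst integrable_cong_AE[OF _ _ z2(1)]) auto
    then show ?thesis
      using True integral_cong_AE[OF _ _ z2(1)] integral_cong_AE[OF _ _ z2(2)] by auto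
  next
    case False
    let ?s = "sqrt \<bar>v\<bar>"
    have s: "0 < ?s" using False by simp
    have sq: "(sqrt v)\<^sup>2 = \<bar>v\<bar>"
      by (metis abs_ge_zero power2_abs real_sqrt_abs' real_sqrt_pow2)
    have "normal_density 0 (sqrt v) = normal_density 0 ?s"
      by (simp add: normal_density_def fun_eq_iff sq)
    then have D: "distributed M lborel Y (\<lambda>x. ennreal (normal_density 0 ?s x))"
      using assms False by (simp add: centered_normal_def)
    have i2: "has_bochner_integral lborel (\<lambda>x. normal_density 0 ?s x * x\<^sup>2) \<bar>v\<bar>"
      using normal_moment_even[OF s, of 0 1] by (simp add: fact_2)
    have i1: "has_bochner_integral lborel (\<lambda>x. normal_density 0 ?s x * \<bar>x\<bar>) (sqrt (2 / pi) * ?s)"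
      using normal_moment_abs_odd[OF s, of 0 0] by (simp add: mult.commute)
    show ?thesis
      using distributed_integral[OF D, of "\<lambda>x. x\<^sup>2"] distributed_integral[OF D, of "\<lambda>x. \<bar>x\<bar>"]
        distributed_integrable[OF D, of "\<lambda>x. x\<^sup>2"] i1 i2
      by (auto simp: has_bochner_integral_iff)
  qed
  then show "integrable M (\<lambda>\<omega>. (Y \<omega>)\<^sup>2)" "expectation (\<lambda>\<omega>. (Y \<omega>)\<^sup>2) = \<bar>v\<bar>"
    "expectation (\<lambda>\<omega>. \<bar>Y \<omega>\<bar>) = sqrt (2 / pi) * sqrt \<bar>v\<bar>" by auto
qed

context prob_space
begin

definition sq_integrable :: "('a \<Rightarrow> real) \<Rightarrow> bool" where
  "sq_integrable f \<longleftrightarrow> f \<in> borel_measurable M \<and> integrable M (\<lambda>\<omega>. (f \<omega>)\<^sup>2)"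

definition ip :: "('a \<Rightarrow> real) \<Rightarrow> ('a \<Rightarrow> real) \<Rightarrow> real" where
  "ip f g = expectation (\<lambda>\<omega>. f \<omega> * g \<omega>)"

definition nrm :: "('a \<Rightarrow> real) \<Rightarrow> real" where
  "nrm f = sqrt (ip f f)"

lemma sq_integrable_measurable: "sq_integrable f \<Longrightarrow> f \<in> borel_measurable M"
  by (simp add: sq_integrable_def)

lemma sq_integrable_mult:
  assumes "sq_integrable f" "sq_integrable g"
  shows "integrable M (\<lambda>\<omega>. f \<omega> * g \<omega>)"
proof (rule Bochner_Integration.integrable_bound[where f="\<lambda>\<omega>. (f \<omega>)\<^sup>2 + (g \<omega>)\<^sup>2"])
  have "\<bar>x * y\<bar> \<le> x\<^sup>2 + y\<^sup>2" for x y :: real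
  proof -
    have "2 * (\<bar>x\<bar> * \<bar>y\<bar>) \<le> \<bar>x\<bar>\<^sup>2 + \<bar>y\<bar>\<^sup>2" using sum_squares_bound[of "\<bar>x\<bar>" "\<bar>y\<bar>"] by simp
    moreover have "0 \<le> \<bar>x\<bar> * \<bar>y\<bar>" by simp
    ultimately show ?thesis unfolding abs_mult by (simp only: power2_abs)
  qed
  then show "AE \<omega> in M. norm (f \<omega> * g \<omega>) \<le> norm ((f \<omega>)\<^sup>2 + (g \<omega>)\<^sup>2)" by (auto intro!: AE_I2)
qed (use assms in \<open>auto simp: sq_integrable_def\<close>)

lemma sq_integrable_integrable: "sq_integrable f \<Longrightarrow> integrable M f"
  by (auto simp: sq_integrable_def intro: square_integrable_imp_integrable)

lemma sq_integrable_add: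
  assumes "sq_integrable f" "sq_integrable g"
  shows "sq_integrable (\<lambda>\<omega>. f \<omega> + g \<omega>)"
  using assms sq_integrable_mult[OF assms] by (auto simp: sq_integrable_def power2_sum mult.assoc)

lemma sq_integrable_scale: "sq_integrable f \<Longrightarrow> sq_integrable (\<lambda>\<omega>. c * f \<omega>)"
  by (auto simp: sq_integrable_def power_mult_distrib)

lemma sq_integrable_diff:
  assumes "sq_integrable f" "sq_integrable g"
  shows "sq_integrable (\<lambda>\<omega>. f \<omega> - g \<omega>)"
  using sq_integrable_add[OF assms(1) sq_integrable_scale[OF assms(2), of "-1"]] by simp

lemma ip_commute: "ip f g = ip g f"
  by (simp add: ip_def mult.commute)

lemma ip_add_left: "sq_integrable f \<Longrightarrow> sq_integrable g \<Longrightarrow> sq_integrable h \<Longrightarrow>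
  ip (\<lambda>\<omega>. f \<omega> + g \<omega>) h = ip f h + ip g h"
  by (simp add: ip_def distrib_right sq_integrable_mult)

lemma ip_diff_left: "sq_integrable f \<Longrightarrow> sq_integrable g \<Longrightarrow> sq_integrable h \<Longrightarrow>
  ip (\<lambda>\<omega>. f \<omega> - g \<omega>) h = ip f h - ip g h"
  by (simp add: ip_def left_diff_distrib sq_integrable_mult)

lemma ip_scale_left: "ip (\<lambda>\<omega>. c * f \<omega>) h = c * ip f h"
  by (simp add: ip_def mult.assoc)

lemma ip_add_right: "sq_integrable f \<Longrightarrow> sq_integrable g \<Longrightarrow> sq_integrable h \<Longrightarrow>
  ip h (\<lambda>\<omega>. f \<omega> + g \<omega>) = ip h f + ip h g"
  by (simp add: ip_add_left ip_commute[of h])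

lemma ip_diff_right: "sq_integrable f \<Longrightarrow> sq_integrable g \<Longrightarrow> sq_integrable h \<Longrightarrow>
  ip h (\<lambda>\<omega>. f \<omega> - g \<omega>) = ip h f - ip h g"
  by (simp add: ip_diff_left ip_commute[of h])

lemma ip_scale_right: "ip h (\<lambda>\<omega>. c * f \<omega>) = c * ip h f"
  by (simp add: ip_scale_left ip_commute[of h])

lemmas ip_bilinear = ip_add_left ip_add_right ip_diff_left ip_diff_right ip_scale_left ip_scale_right
  sq_integrable_add sq_integrable_diff sq_integrable_scale

lemma ip_self_nonneg: "0 \<le> ip f f"
  unfolding ip_def by (intro Bochner_Integration.integral_nonneg) auto

lemma nrm_nonneg: "0 \<le> nrm f"
  by (simp add: nrm_def ip_self_nonneg)

lemma nrm_square: "(nrm f)\<^sup>2 = ip f f"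
  by (simp add: nrm_def ip_self_nonneg)

text \<open>Functions are not identified up to null sets, so \<open>nrm\<close> is only a seminorm.
  This settles the degenerate case here and wherever a quotient by \<open>nrm\<close> occurs, since
  then numerator and quotient both vanish.\<close>

lemma ip_eq_0:
  assumes "sq_integrable f" "sq_integrable g" "nrm f = 0"
  shows "ip f g = 0"
proof -
  have "expectation (\<lambda>\<omega>. f \<omega> * f \<omega>) = 0" using nrm_square[of f] assms(3) by (simp add: ip_def)
  then have "AE \<omega> in M. f \<omega> * f \<omega> = 0"
    using integral_nonneg_eq_0_iff_AE[of M "\<lambda>\<omega>. f \<omega> * f \<omega>"] sq_integrable_mult[OF assms(1,1)] by auto
  then have "AE \<omega> in M. f \<omega> * g \<omega> = 0" by auto
  then show ?thesis unfolding ip_def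
    using integral_cong_AE[of "\<lambda>\<omega>. f \<omega> * g \<omega>" M "\<lambda>_. 0"] assms by (auto simp: sq_integrable_def)
qed

lemma abs_ip_le:
  assumes f: "sq_integrable f" and g: "sq_integrable g"
  shows "\<bar>ip f g\<bar> \<le> nrm f * nrm g"
proof (cases "nrm f = 0")
  case True
  then show ?thesis using ip_eq_0[OF f g] by simp
next
  case False
  then have n: "0 < (nrm f)\<^sup>2" by simp
  \<comment> \<open>The coefficient of the orthogonal projection of \<open>g\<close> onto
    \<open>f\<close>; the residual has a nonnegative square norm.\<close>
  let ?c = "ip f g / (nrm f)\<^sup>2"
  have "0 \<le> ip (\<lambda>\<omega>. g \<omega> - ?c * f \<omega>) (\<lambda>\<omega>. g \<omega> - ?c * f \<omega>)" by (rule ip_self_nonneg)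
  also have "\<dots> = ip g g - ?c * ip f g - ?c * (ip f g - ?c * ip f f)"
  proof -
    have "ip (\<lambda>\<omega>. g \<omega> - c * f \<omega>) (\<lambda>\<omega>. g \<omega> - c * f \<omega>) = ip g g - c * ip f g - c * (ip f g - c * ip f f)" for c
      using f g by (simp add: ip_bilinear ip_commute[of g f])
    then show ?thesis .
  qed
  also have "\<dots> = (nrm g)\<^sup>2 - (ip f g)\<^sup>2 / (nrm f)\<^sup>2"
    using n by (simp add: nrm_square[symmetric] field_simps power2_eq_square)
  finally have "(ip f g)\<^sup>2 \<le> (nrm f * nrm g)\<^sup>2"
    using n by (simp add: field_simps power_mult_distrib)
  then show ?thesis
    using nrm_nonneg[of f] nrm_nonneg[of g] abs_le_square_iff[of "ip f g" "nrm f * nrm g"] by simp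
qed

lemma nrm_add_le:
  assumes f: "sq_integrable f" and g: "sq_integrable g"
  shows "nrm (\<lambda>\<omega>. f \<omega> + g \<omega>) \<le> nrm f + nrm g"
proof (rule power2_le_imp_le)
  have "(nrm (\<lambda>\<omega>. f \<omega> + g \<omega>))\<^sup>2 = (nrm f)\<^sup>2 + 2 * ip f g + (nrm g)\<^sup>2"
    unfolding nrm_square using f g by (simp add: ip_bilinear ip_commute[of g f])
  also have "\<dots> \<le> (nrm f + nrm g)\<^sup>2"
    using abs_ip_le[OF f g] by (simp add: power2_sum)
  finally show "(nrm (\<lambda>\<omega>. f \<omega> + g \<omega>))\<^sup>2 \<le> (nrm f + nrm g)\<^sup>2" .
qed (simp add: nrm_nonneg)

lemma nrm_scale: "nrm (\<lambda>\<omega>. c * f \<omega>) = \<bar>c\<bar> * nrm f"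
  by (simp add: nrm_def ip_scale_left ip_scale_right real_sqrt_mult mult.assoc[symmetric])

lemma nrm_diff_le:
  assumes f: "sq_integrable f" and g: "sq_integrable g"
  shows "nrm (\<lambda>\<omega>. f \<omega> - g \<omega>) \<le> nrm f + nrm g"
  using nrm_add_le[OF f sq_integrable_scale[OF g, of "-1"]] nrm_scale[of "-1" g] by simp

lemma sq_integrable_sum:
  assumes "\<And>i. i \<in> I \<Longrightarrow> sq_integrable (f i)"
  shows "sq_integrable (\<lambda>\<omega>. \<Sum>i\<in>I. f i \<omega>)"
  using assms
proof (induction I rule: infinite_finite_induct)
  case (insert i I)
  then show ?case using sq_integrable_add[of "f i" "\<lambda>\<omega>. \<Sum>i\<in>I. f i \<omega>"] by auto
qed (auto simp: sq_integrable_def)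

lemma nrm_sum_le:
  assumes "\<And>i. i \<in> I \<Longrightarrow> sq_integrable (f i)"
  shows "nrm (\<lambda>\<omega>. \<Sum>i\<in>I. f i \<omega>) \<le> (\<Sum>i\<in>I. nrm (f i))"
  using assms
proof (induction I rule: infinite_finite_induct)
  case (insert i I)
  then have "nrm (\<lambda>\<omega>. f i \<omega> + (\<Sum>i\<in>I. f i \<omega>)) \<le> nrm (f i) + nrm (\<lambda>\<omega>. \<Sum>i\<in>I. f i \<omega>)"
    by (intro nrm_add_le sq_integrable_sum) auto
  also have "\<dots> \<le> nrm (f i) + (\<Sum>i\<in>I. nrm (f i))"
    using insert by auto
  finally show ?case using insert by simp
qed (auto simp: nrm_def ip_def)

lemma nrm_mult_bounded:
  assumes f: "sq_integrable f" and [measurable]: "g \<in> borel_measurable M"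
    and g: "\<And>\<omega>. \<omega> \<in> space M \<Longrightarrow> \<bar>g \<omega>\<bar> \<le> c" and c: "0 \<le> c"
  shows "sq_integrable (\<lambda>\<omega>. g \<omega> * f \<omega>)" "nrm (\<lambda>\<omega>. g \<omega> * f \<omega>) \<le> c * nrm f"
proof -
  have [measurable]: "f \<in> borel_measurable M" using f by (rule sq_integrable_measurable)
  have le: "(g \<omega> * f \<omega>)\<^sup>2 \<le> (c * f \<omega>)\<^sup>2" if "\<omega> \<in> space M" for \<omega>
  proof -
    have "\<bar>g \<omega> * f \<omega>\<bar> \<le> \<bar>c * f \<omega>\<bar>"
      using g[OF that] c unfolding abs_mult by (intro mult_right_mono) auto
    then show ?thesis by (simp add: abs_le_square_iff)
  qed
  have ic: "integrable M (\<lambda>\<omega>. (c * f \<omega>)\<^sup>2)" using sq_integrable_scale[OF f, of c] by (simp add: sq_integrable_def)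
  have ig: "integrable M (\<lambda>\<omega>. (g \<omega> * f \<omega>)\<^sup>2)"
    by (rule Bochner_Integration.integrable_bound[OF ic]) (use le in \<open>auto intro!: AE_I2\<close>)
  then show "sq_integrable (\<lambda>\<omega>. g \<omega> * f \<omega>)" by (simp add: sq_integrable_def)
  have "ip (\<lambda>\<omega>. g \<omega> * f \<omega>) (\<lambda>\<omega>. g \<omega> * f \<omega>) \<le> ip (\<lambda>\<omega>. c * f \<omega>) (\<lambda>\<omega>. c * f \<omega>)"
    unfolding ip_def power2_eq_square[symmetric] by (rule integral_mono[OF ig ic le])
  then have "nrm (\<lambda>\<omega>. g \<omega> * f \<omega>) \<le> nrm (\<lambda>\<omega>. c * f \<omega>)" by (simp add: nrm_def)
  then show "nrm (\<lambda>\<omega>. g \<omega> * f \<omega>) \<le> c * nrm f" using c by (simp add: nrm_scale)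
qed

text \<open>The part of \<open>S\<close> below \<open>\<mu> / 2\<close> accounts for at most half of
  the mean, so the event carries the other half, and Cauchy--Schwarz bounds that half by
  \<open>nrm S * sqrt (prob ?E)\<close>.\<close>

lemma paley_zygmund:
  assumes S: "sq_integrable S" and \<mu>: "0 < \<mu>" "\<mu> \<le> expectation S" and R: "nrm S \<le> R * \<mu>" "0 < R"
  shows "1 / (4 * R\<^sup>2) \<le> prob {\<omega> \<in> space M. \<mu> / 2 \<le> S \<omega>}"
proof -
  let ?E = "{\<omega> \<in> space M. \<mu> / 2 \<le> S \<omega>}"
  have [measurable]: "S \<in> borel_measurable M" using S by (rule sq_integrable_measurable)
  have [measurable]: "?E \<in> events" by measurable
  have ind: "sq_integrable (indicator ?E)" "nrm (indicator ?E) = sqrt (prob ?E)"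
    by (auto simp: sq_integrable_def nrm_def ip_def indicator_inter_arith[symmetric] power2_eq_square emeasure_eq_measure)
  have "expectation S \<le> expectation (\<lambda>\<omega>. \<mu> / 2 + S \<omega> * indicator ?E \<omega>)"
  proof (rule integral_mono)
    show "integrable M (\<lambda>\<omega>. \<mu> / 2 + S \<omega> * indicator ?E \<omega>)"
      by (intro Bochner_Integration.integrable_add sq_integrable_mult[OF S ind(1)]) auto
    show "S \<omega> \<le> \<mu> / 2 + S \<omega> * indicator ?E \<omega>" if "\<omega> \<in> space M" for \<omega>
      using \<mu> that by (auto simp: indicator_def)
  qed (rule sq_integrable_integrable[OF S])
  also have "\<dots> = \<mu> / 2 + ip S (indicator ?E)"
    using sq_integrable_mult[OF S ind(1)] by (simp add: ip_def prob_space)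
  also have "\<dots> \<le> \<mu> / 2 + nrm S * sqrt (prob ?E)"
    using abs_ip_le[OF S ind(1)] ind(2) by simp
  also have "\<dots> \<le> \<mu> / 2 + R * \<mu> * sqrt (prob ?E)"
    using R(1) by (intro add_left_mono mult_right_mono) auto
  finally have "\<mu> * (1 / 2) \<le> \<mu> * (R * sqrt (prob ?E))"
    using \<mu>(2) by (simp add: mult_ac)
  then have "1 / 2 \<le> R * sqrt (prob ?E)" using \<mu>(1) by (simp only: mult_le_cancel_left_pos)
  then have "1 / (2 * R) \<le> sqrt (prob ?E)" using R(2) by (simp add: field_simps)
  then have "(1 / (2 * R))\<^sup>2 \<le> (sqrt (prob ?E))\<^sup>2" using R(2) by (intro power_mono) auto
  then show ?thesis by (simp add: power_divide power_mult_distrib)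
qed

text \<open>The convex function \<open>t \<mapsto> E |U + t V|\<close> equals \<open>sqrt (2 / pi) * nrm (U + t V)\<close> and has the
  subgradient \<open>E (sgn U * V)\<close> at \<open>t = 0\<close>.\<close>

lemma expectation_sgn_mult:
  assumes U: "sq_integrable U" and V: "sq_integrable V" and pos: "0 < nrm U"
    and abs_moment: "\<And>t. expectation (\<lambda>\<omega>. \<bar>U \<omega> + t * V \<omega>\<bar>) = sqrt (2 / pi) * nrm (\<lambda>\<omega>. U \<omega> + t * V \<omega>)"
  shows "expectation (\<lambda>\<omega>. sgn (U \<omega>) * V \<omega>) = sqrt (2 / pi) * (ip U V / nrm U)"
proof -
  let ?a = "expectation (\<lambda>\<omega>. sgn (U \<omega>) * V \<omega>)" and ?k = "sqrt (2 / pi)"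
  \<comment> \<open>The gap between \<open>E |U + t V|\<close> and its supporting line at 0. It is
    nonnegative and vanishes at \<open>t = 0\<close>, so its derivative there is 0, which is the
    claim. No joint law or conditioning is needed.\<close>
  define f where "f t = ?k * sqrt (ip U U + 2 * t * ip U V + t\<^sup>2 * ip V V) - ?k * nrm U - t * ?a" for t
  have [measurable]: "U \<in> borel_measurable M" "V \<in> borel_measurable M"
    using U V by (auto intro: sq_integrable_measurable)
  have int: "integrable M (\<lambda>\<omega>. sgn (U \<omega>) * V \<omega>)"
    by (rule sq_integrable_integrable, rule nrm_mult_bounded(1)[OF V, where c=1]) (auto simp: sgn_if)
  have nrm_t: "nrm (\<lambda>\<omega>. U \<omega> + t * V \<omega>) = sqrt (ip U U + 2 * t * ip U V + t\<^sup>2 * ip V V)" for t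
    unfolding nrm_def using U V by (simp add: ip_bilinear ip_commute[of V U] power2_eq_square algebra_simps)
  have f0: "f 0 = 0" by (simp add: f_def nrm_def)
  have "0 \<le> f t" for t
  proof -
    have "expectation (\<lambda>\<omega>. \<bar>U \<omega>\<bar> + t * (sgn (U \<omega>) * V \<omega>)) \<le> expectation (\<lambda>\<omega>. \<bar>U \<omega> + t * V \<omega>\<bar>)"
    proof (rule integral_mono)
      show "\<bar>U \<omega>\<bar> + t * (sgn (U \<omega>) * V \<omega>) \<le> \<bar>U \<omega> + t * V \<omega>\<bar>" for \<omega>
        by (auto simp: sgn_if)
    qed (use sq_integrable_integrable[OF U] sq_integrable_integrable[OF V] int in auto)
    also have "expectation (\<lambda>\<omega>. \<bar>U \<omega>\<bar> + t * (sgn (U \<omega>) * V \<omega>)) = ?k * nrm U + t * ?a"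
      using abs_moment[of 0] U int by (simp add: sq_integrable_integrable)
    finally show ?thesis using nrm_t[of t] by (simp add: f_def abs_moment)
  qed
  moreover have "(f has_real_derivative (?k * (ip U V / nrm U) - ?a)) (at 0)"
  proof -
    have "0 < ip U U" using pos by (simp add: nrm_def)
    then show ?thesis
      unfolding f_def nrm_def
      by (auto intro!: derivative_eq_intros simp: field_simps)
  qed
  ultimately have "?k * (ip U V / nrm U) - ?a = 0"
    using f0 by (intro DERIV_local_min[where d=1]) auto
  then show ?thesis by simp
qed

end

section \<open>Fractional Brownian motion\<close>

text \<open>Two applications of the mean value theorem reduce the mixed difference to
  \<open>p * q\<close> times the second derivative of \<open>z powr (2*H)\<close> at a point beyond
  \<open>\<delta>\<close>. Its exponent \<open>2*H - 2\<close> is negative, so the value at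
  \<open>\<delta>\<close> is the worst, and
  \<open>\<bar>2*H * (2*H - 1)\<bar> \<le> 2\<close>.\<close>

lemma powr_second_difference_le:
  fixes d p q \<delta> H :: real
  assumes H: "0 < H" "H < 1" and \<delta>: "0 < \<delta>" and p: "0 < p" and q: "0 < q" and d: "\<delta> \<le> d - p"
  shows "\<bar>((d + q) powr (2*H) - d powr (2*H)) - ((d - p + q) powr (2*H) - (d - p) powr (2*H))\<bar>
    \<le> 2 * \<delta> powr (2*H - 2) * p * q"
proof -
  define g where "g z = (z + q) powr (2*H) - z powr (2*H)" for z
  define g' where "g' z = 2*H * (z + q) powr (2*H - 1) - 2*H * z powr (2*H - 1)" for z
  have "(g has_real_derivative g' z) (at z)" if "d - p \<le> z" for z
    unfolding g_def g'_def using that d \<delta> q by (auto intro!: derivative_eq_intros)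
  then obtain z where z: "d - p < z" "g d - g (d - p) = (d - (d - p)) * g' z"
    using MVT2[of "d - p" d g g'] p by auto
  define h where "h w = 2*H * w powr (2*H - 1)" for w
  define h' where "h' w = 2*H * ((2*H - 1) * w powr (2*H - 2))" for w
  have "(h has_real_derivative h' w) (at w)" if "z \<le> w" for w
    unfolding h_def h'_def using that d \<delta> z by (auto intro!: derivative_eq_intros)
  then obtain w where w: "z < w" "h (z + q) - h z = (z + q - z) * h' w"
    using MVT2[of z "z + q" h h'] q by auto
  have "\<bar>h' w\<bar> = \<bar>2*H * (2*H - 1)\<bar> * w powr (2*H - 2)"
    by (simp add: h'_def abs_mult mult.assoc)
  also have "\<dots> \<le> 2 * \<delta> powr (2*H - 2)"
  proof (rule mult_mono)
    have "\<bar>2*H * (2*H - 1)\<bar> = 2*H * \<bar>2*H - 1\<bar>" using H by (simp add: abs_mult)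
    also have "\<dots> \<le> 2 * 1" using H by (intro mult_mono) auto
    finally show "\<bar>2*H * (2*H - 1)\<bar> \<le> 2" by simp
    show "w powr (2*H - 2) \<le> \<delta> powr (2*H - 2)"
      using H \<delta> d z(1) w(1) by (intro powr_mono2') auto
  qed auto
  finally have "p * q * \<bar>h' w\<bar> \<le> p * q * (2 * \<delta> powr (2*H - 2))"
    using p q by (intro mult_left_mono) auto
  moreover have "\<bar>g d - g (d - p)\<bar> = p * q * \<bar>h' w\<bar>"
    using z(2) w(2) p q by (simp add: g'_def h_def abs_mult)
  ultimately show ?thesis by (simp add: g_def mult_ac)
qed

locale fractional_brownian_motion = prob_space M for M :: "'a measure" +
  fixes H :: real and W :: "real \<Rightarrow> 'a \<Rightarrow> real"
  assumes H_pos: "0 < H" and H_less_1: "H < 1" and fbm: "fbm M H W"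
begin

text \<open>Equality is only required on \<open>space M\<close>, since a path starts at 0 only there.\<close>

definition gauss_span :: "('a \<Rightarrow> real) set" where
  "gauss_span = {Z. \<exists>xs. (\<forall>(c, t)\<in>set xs. 0 \<le> t) \<and> (\<forall>\<omega>\<in>space M. Z \<omega> = (\<Sum>(c, t)\<leftarrow>xs. c * W t \<omega>))}"

lemma gauss_span_cong:
  assumes "Z \<in> gauss_span" "\<And>\<omega>. \<omega> \<in> space M \<Longrightarrow> Z' \<omega> = Z \<omega>"
  shows "Z' \<in> gauss_span"
  using assms unfolding gauss_span_def by auto

lemma gauss_span_W: "0 \<le> t \<Longrightarrow> W t \<in> gauss_span"
  unfolding gauss_span_def by (auto intro!: exI[of _ "[(1, t)]"])

lemma gauss_span_zero: "(\<lambda>\<omega>. 0) \<in> gauss_span"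
  unfolding gauss_span_def by (auto intro!: exI[of _ "[]"])

text \<open>With lists that may repeat a time, addition is concatenation; \<open>fbm\<close> also
  admits families with repeated times.\<close>

lemma gauss_span_add:
  assumes "Y \<in> gauss_span" "Z \<in> gauss_span"
  shows "(\<lambda>\<omega>. Y \<omega> + Z \<omega>) \<in> gauss_span"
proof -
  obtain xs ys where xs: "\<forall>(c, t)\<in>set xs. 0 \<le> t" "\<forall>\<omega>\<in>space M. Y \<omega> = (\<Sum>(c, t)\<leftarrow>xs. c * W t \<omega>)"
    and ys: "\<forall>(c, t)\<in>set ys. 0 \<le> t" "\<forall>\<omega>\<in>space M. Z \<omega> = (\<Sum>(c, t)\<leftarrow>ys. c * W t \<omega>)"
    using assms unfolding gauss_span_def by blast
  then show ?thesis unfolding gauss_span_def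
    by (intro CollectI exI[of _ "xs @ ys"]) auto
qed

lemma gauss_span_scale:
  assumes "Z \<in> gauss_span"
  shows "(\<lambda>\<omega>. a * Z \<omega>) \<in> gauss_span"
proof -
  obtain xs where xs: "\<forall>(c, t)\<in>set xs. 0 \<le> t" "\<forall>\<omega>\<in>space M. Z \<omega> = (\<Sum>(c, t)\<leftarrow>xs. c * W t \<omega>)"
    using assms unfolding gauss_span_def by blast
  moreover have "(\<Sum>(c, t)\<leftarrow>map (\<lambda>(c, t). (a * c, t)) xs. c * W t \<omega>) = a * (\<Sum>(c, t)\<leftarrow>xs. c * W t \<omega>)" for \<omega>
    by (induction xs) (auto simp: algebra_simps)
  ultimately show ?thesis unfolding gauss_span_def
    by (intro CollectI exI[of _ "map (\<lambda>(c, t). (a * c, t)) xs"]) auto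
qed

lemma gauss_span_diff:
  assumes "Y \<in> gauss_span" "Z \<in> gauss_span"
  shows "(\<lambda>\<omega>. Y \<omega> - Z \<omega>) \<in> gauss_span"
  using gauss_span_add[OF assms(1) gauss_span_scale[OF assms(2), of "-1"]] by simp

lemma gauss_span_sum:
  assumes "\<And>i. i \<in> I \<Longrightarrow> Z i \<in> gauss_span"
  shows "(\<lambda>\<omega>. \<Sum>i\<in>I. Z i \<omega>) \<in> gauss_span"
  using assms
proof (induction I rule: infinite_finite_induct)
  case (insert i I)
  then show ?case using gauss_span_add[of "Z i" "\<lambda>\<omega>. \<Sum>i\<in>I. Z i \<omega>"] by auto
qed (auto simp: gauss_span_zero)

lemma centered_normal_combination:
  assumes "\<forall>(c, t)\<in>set xs. 0 \<le> t"
  shows "centered_normal M (\<lambda>\<omega>. \<Sum>(c, t)\<leftarrow>xs. c * W t \<omega>)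
    (\<Sum>i<length xs. \<Sum>j<length xs. fst (xs ! i) * fst (xs ! j) * fbm_cov H (snd (xs ! i)) (snd (xs ! j)))"
proof -
  have eq: "(\<lambda>\<omega>. \<Sum>(c, t)\<leftarrow>xs. c * W t \<omega>) = (\<lambda>\<omega>. \<Sum>i<length xs. fst (xs ! i) * W (snd (xs ! i)) \<omega>)"
    by (auto simp: sum_list_sum_nth case_prod_unfold atLeast0LessThan intro!: sum.cong)
  have nonneg: "\<forall>i<length xs. 0 \<le> snd (xs ! i)"
  proof (intro allI impI)
    fix i assume "i < length xs"
    then have "xs ! i \<in> set xs" by simp
    then show "0 \<le> snd (xs ! i)" using assms by (auto simp: case_prod_unfold)
  qed
  have *: "centered_normal M (\<lambda>\<omega>. \<Sum>i<n. c i * W (t i) \<omega>)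
      (\<Sum>i<n. \<Sum>j<n. c i * c j * fbm_cov H (t i) (t j))" if "\<forall>i<n. 0 \<le> t i" for n :: nat and t c
    by (rule fbm[unfolded fbm_def, THEN conjunct2, THEN conjunct2, THEN conjunct2, THEN spec, THEN spec, THEN spec, THEN mp, OF that])
  show ?thesis
    unfolding eq by (rule *[OF nonneg])
qed

text \<open>Together with closure under linear combinations, these are the two consequences of
  Gaussianity on which the sign estimates rest: the first absolute moment is a fixed multiple of the
  \<open>L2\<close> norm on the whole span.\<close>

lemma gauss_span_sq_integrable: "Z \<in> gauss_span \<Longrightarrow> sq_integrable Z"
  and gauss_span_abs_moment: "Z \<in> gauss_span \<Longrightarrow> expectation (\<lambda>\<omega>. \<bar>Z \<omega>\<bar>) = sqrt (2 / pi) * nrm Z"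
proof -
  assume "Z \<in> gauss_span"
  then obtain xs where xs: "\<forall>(c, t)\<in>set xs. 0 \<le> t" "\<forall>\<omega>\<in>space M. Z \<omega> = (\<Sum>(c, t)\<leftarrow>xs. c * W t \<omega>)"
    unfolding gauss_span_def by blast
  let ?Y = "\<lambda>\<omega>. \<Sum>(c, t)\<leftarrow>xs. c * W t \<omega>"
  note m = centered_normal_moments[OF centered_normal_combination[OF xs(1)]]
  have "Z \<in> borel_measurable M"
    using m(1) xs(2) by (subst measurable_cong[of M Z ?Y]) auto
  moreover have "integrable M (\<lambda>\<omega>. (Z \<omega>)\<^sup>2)"
    using m(2) xs(2) by (subst Bochner_Integration.integrable_cong[of M M _ "\<lambda>\<omega>. (?Y \<omega>)\<^sup>2"]) auto
  ultimately show "sq_integrable Z" by (simp add: sq_integrable_def)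
  have "expectation (\<lambda>\<omega>. \<bar>Z \<omega>\<bar>) = expectation (\<lambda>\<omega>. \<bar>?Y \<omega>\<bar>)"
    "expectation (\<lambda>\<omega>. (Z \<omega>)\<^sup>2) = expectation (\<lambda>\<omega>. (?Y \<omega>)\<^sup>2)"
    using xs(2) by (auto intro!: Bochner_Integration.integral_cong)
  then show "expectation (\<lambda>\<omega>. \<bar>Z \<omega>\<bar>) = sqrt (2 / pi) * nrm Z"
    using m(3,4) by (simp add: nrm_def ip_def power2_eq_square)
qed

text \<open>The deterministic sign of the covariance makes the mean nonnegative, so that
  contributions of different cells cannot cancel. If \<open>nrm U = 0\<close>, both sides are 0, the
  right one by the convention for division by zero.\<close>

lemma expectation_sgn_gauss:
  assumes U: "U \<in> gauss_span" and V: "V \<in> gauss_span"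
  shows "expectation (\<lambda>\<omega>. sgn (ip U V) * (sgn (U \<omega>) * V \<omega>)) = sqrt (2 / pi) * (\<bar>ip U V\<bar> / nrm U)"
proof (cases "nrm U = 0")
  case True
  then show ?thesis
    using ip_eq_0[OF gauss_span_sq_integrable[OF U] gauss_span_sq_integrable[OF V]] by simp
next
  case False
  then have "0 < nrm U" using nrm_nonneg[of U] by simp
  then have "expectation (\<lambda>\<omega>. sgn (U \<omega>) * V \<omega>) = sqrt (2 / pi) * (ip U V / nrm U)"
    using U V by (intro expectation_sgn_mult gauss_span_abs_moment gauss_span_add gauss_span_scale
        gauss_span_sq_integrable)
  then show ?thesis by (simp only: Bochner_Integration.integral_mult_right_zero abs_sgn) simp
qed

lemma ip_W_diff: "0 \<le> s \<Longrightarrow> 0 \<le> t \<Longrightarrow> ip (\<lambda>\<omega>. W t \<omega> - W s \<omega>) (\<lambda>\<omega>. W t \<omega> - W s \<omega>) = \<bar>t - s\<bar> powr (2*H)"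
  using centered_normal_moments(3)[OF centered_normal_combination[of "[(1, t), (-1, s)]"]]
  by (simp add: ip_def power2_eq_square fbm_cov_def lessThan_Suc numeral_2_eq_2 abs_minus_commute algebra_simps)

lemma ip_W_self: "0 \<le> t \<Longrightarrow> ip (W t) (W t) = t powr (2*H)"
  using centered_normal_moments(3)[OF centered_normal_combination[of "[(1, t)]"]]
  by (simp add: ip_def power2_eq_square fbm_cov_def)

lemma sq_integrable_W: "0 \<le> t \<Longrightarrow> sq_integrable (W t)"
  by (intro gauss_span_sq_integrable gauss_span_W)

text \<open>By polarisation. \<open>centered_normal_moments\<close> gives variances only up to an
  absolute value, which is harmless for the manifestly nonnegative variances of values and
  increments.\<close>

lemma ip_W: 
  assumes "0 \<le> s" "0 \<le> t"
  shows "ip (W s) (W t) = fbm_cov H s t"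
proof -
  have "\<bar>t - s\<bar> powr (2*H) = ip (W t) (W t) - ip (W s) (W t) - (ip (W t) (W s) - ip (W s) (W s))"
    unfolding ip_W_diff[OF assms, symmetric]
    using sq_integrable_W assms by (simp only: ip_diff_left ip_diff_right sq_integrable_diff)
  also have "\<dots> = t powr (2*H) + s powr (2*H) - 2 * ip (W s) (W t)"
    using ip_commute[of "W t" "W s"] by (simp only: ip_W_self assms)
  finally show ?thesis unfolding fbm_cov_def by simp
qed

definition dW :: "real \<Rightarrow> real \<Rightarrow> 'a \<Rightarrow> real" where
  "dW x p \<omega> = W (x + p) \<omega> - W x \<omega>"

lemma dW_gauss: "0 \<le> x \<Longrightarrow> 0 \<le> p \<Longrightarrow> dW x p \<in> gauss_span"
  unfolding dW_def[abs_def] by (intro gauss_span_diff gauss_span_W) auto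

lemma ip_dW_self: "0 \<le> x \<Longrightarrow> 0 \<le> p \<Longrightarrow> ip (dW x p) (dW x p) = p powr (2*H)"
  unfolding dW_def[abs_def] by (subst ip_W_diff) auto

lemma nrm_dW: "0 \<le> x \<Longrightarrow> 0 \<le> p \<Longrightarrow> nrm (dW x p) = p powr H"
  by (simp add: nrm_def ip_dW_self powr_half_sqrt[symmetric] powr_powr)

text \<open>Twice the covariance is a mixed second difference of \<open>z powr (2*H)\<close>. For
  lengths of order \<open>m\<close> and a fixed gap this gives \<open>m\<^sup>2\<close>, which is
  negligible against the variance \<open>m powr (2*H)\<close> because \<open>H < 1\<close>.\<close>

lemma abs_ip_dW_le:
  assumes "0 \<le> x" "0 < p" "0 < q" "0 < \<delta>" "x + p + \<delta> \<le> y"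
  shows "\<bar>ip (dW x p) (dW y q)\<bar> \<le> \<delta> powr (2*H - 2) * p * q"
proof -
  have "2 * ip (dW x p) (dW y q) = (y - x + q) powr (2*H) - (y - x) powr (2*H)
      - ((y - x - p + q) powr (2*H) - (y - x - p) powr (2*H))"
  proof -
    have [simp]: "\<bar>y + q - (x + p)\<bar> = y - x - p + q" "\<bar>y - (x + p)\<bar> = y - x - p"
      "\<bar>y + q - x\<bar> = y - x + q" "\<bar>y - x\<bar> = y - x" using assms by auto
    have "ip (dW x p) (dW y q) = fbm_cov H (x + p) (y + q) - fbm_cov H x (y + q) - (fbm_cov H (x + p) y - fbm_cov H x y)"
      unfolding dW_def[abs_def] using assms
      by (simp only: ip_diff_left ip_diff_right sq_integrable_diff sq_integrable_W ip_W
          add_nonneg_nonneg less_imp_le add_pos_pos order_trans[OF _ assms(5)])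
    then show ?thesis
      by (simp add: fbm_cov_def diff_divide_distrib add_divide_distrib)
  qed
  then show ?thesis
    using powr_second_difference_le[OF H_pos H_less_1 assms(4,2,3), of "y - x"] assms
    by (simp add: mult_ac)
qed

end

section \<open>Lower bounds for correlations from a mixed covariance\<close>

context prob_space
begin

lemma nrm_diff_commute: "nrm (\<lambda>\<omega>. f \<omega> - g \<omega>) = nrm (\<lambda>\<omega>. g \<omega> - f \<omega>)"
  using nrm_scale[of "-1" "\<lambda>\<omega>. f \<omega> - g \<omega>"] by simp

lemma nrm_le_add_diff:
  assumes "sq_integrable f" "sq_integrable g"
  shows "nrm f \<le> nrm g + nrm (\<lambda>\<omega>. f \<omega> - g \<omega>)"
  using nrm_add_le[OF assms(2) sq_integrable_diff[OF assms]] by simp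

text \<open>If one of the norms exceeds \<open>4 * e\<close>, all four variables are nearly equal relative to their
  size; otherwise the lower bound on the mixed covariance decides.\<close>

lemma correlation_dichotomy:
  fixes V1 V2 V3 V4 :: "'a \<Rightarrow> real"
  assumes V: "sq_integrable V1" "sq_integrable V2" "sq_integrable V3" "sq_integrable V4"
    and e: "0 < e"
      "nrm (\<lambda>\<omega>. V1 \<omega> - V2 \<omega>) \<le> e" "nrm (\<lambda>\<omega>. V1 \<omega> - V3 \<omega>) \<le> e" "nrm (\<lambda>\<omega>. V1 \<omega> - V4 \<omega>) \<le> e"
    and J: "0 < J" "J \<le> ip (\<lambda>\<omega>. V1 \<omega> - V2 \<omega>) (\<lambda>\<omega>. V3 \<omega> - V4 \<omega>)"
    and \<Gamma>: "\<Gamma> = \<bar>ip V1 V3\<bar> / nrm V1 + \<bar>ip V2 V3\<bar> / nrm V2 + (\<bar>ip V1 V4\<bar> / nrm V1 + \<bar>ip V2 V4\<bar> / nrm V2)"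
  shows "min (1/4) (J / (32 * e\<^sup>2)) * (nrm V3 + nrm V4) \<le> \<Gamma>" "min e (J / (4 * e)) \<le> \<Gamma>"
proof -
  define a1 a2 a3 a4 where "a1 = nrm V1" and "a2 = nrm V2" and "a3 = nrm V3" and "a4 = nrm V4"
  note a_def = a1_def a2_def a3_def a4_def
  have nn: "0 \<le> a1" "0 \<le> a2" "0 \<le> a3" "0 \<le> a4" by (auto simp: a_def nrm_nonneg)
  have tri: "a1 \<le> a2 + e" "a2 \<le> a1 + e" "a1 \<le> a3 + e" "a3 \<le> a1 + e" "a1 \<le> a4 + e" "a4 \<le> a1 + e"
    using nrm_le_add_diff[OF V(1,2)] nrm_le_add_diff[OF V(2,1)] nrm_le_add_diff[OF V(1,3)]
      nrm_le_add_diff[OF V(3,1)] nrm_le_add_diff[OF V(1,4)] nrm_le_add_diff[OF V(4,1)] e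
    by (auto simp: a_def nrm_diff_commute[of V2 V1] nrm_diff_commute[of V3 V1] nrm_diff_commute[of V4 V1])
  have \<Gamma>13: "\<bar>ip V1 V3\<bar> / a1 \<le> \<Gamma>" using nn by (simp add: \<Gamma> a_def)
  have "min (1/4) (J / (32 * e\<^sup>2)) * (a3 + a4) \<le> \<Gamma> \<and> min e (J / (4 * e)) \<le> \<Gamma>"
  proof (cases "a1 < 4 * e \<and> a2 < 4 * e \<and> a3 < 4 * e \<and> a4 < 4 * e")
    case True
    \<comment> \<open>All norms are below \<open>4 * e\<close>, so normalising costs at most this
      factor. Then \<open>\<Gamma>\<close> is at least \<open>J / (4 * e)\<close>, while
      \<open>a3 + a4\<close> is below \<open>8 * e\<close>; the ratio is the constant
      \<open>J / (32 * e\<^sup>2)\<close>.\<close>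
    have le: "\<bar>ip U V\<bar> / (4 * e) \<le> \<bar>ip U V\<bar> / nrm U" if "sq_integrable U" "sq_integrable V" "nrm U < 4 * e" for U V
    proof (cases "nrm U = 0")
      case True
      then show ?thesis using ip_eq_0[OF that(1,2)] by simp
    next
      case False
      then show ?thesis using that(3) nrm_nonneg[of U] by (intro divide_left_mono mult_pos_pos) (auto simp: e)
    qed
    have "J \<le> \<bar>ip V1 V3\<bar> + \<bar>ip V2 V3\<bar> + (\<bar>ip V1 V4\<bar> + \<bar>ip V2 V4\<bar>)"
      using J(2) V by (simp add: ip_bilinear)
    then have "J / (4 * e) \<le> (\<bar>ip V1 V3\<bar> + \<bar>ip V2 V3\<bar> + (\<bar>ip V1 V4\<bar> + \<bar>ip V2 V4\<bar>)) / (4 * e)"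
      using e(1) by (intro divide_right_mono) auto
    also have "\<dots> \<le> \<Gamma>"
      unfolding \<Gamma> add_divide_distrib using True V by (intro add_mono le) (auto simp: a_def)
    finally have *: "J / (4 * e) \<le> \<Gamma>" .
    have "min (1/4) (J / (32 * e\<^sup>2)) * (a3 + a4) \<le> J / (32 * e\<^sup>2) * (8 * e)"
      using True nn J(1) e(1) by (intro mult_mono) auto
    also have "\<dots> = J / (4 * e)" using e(1) by (simp add: power2_eq_square field_simps)
    finally show ?thesis using * by simp
  next
    case False
    \<comment> \<open>Now \<open>V1\<close> and \<open>V3\<close> are nearly parallel:
      \<open>ip V1 V3\<close> is at least \<open>2/3 * a1\<^sup>2\<close>, so a single summand
      already gives \<open>\<Gamma> \<ge> 2/3 * a1\<close>. Since
      \<open>a3 + a4 \<le> 2 * (a1 + e) \<le> 8/3 * a1\<close>, the constant \<open>1/4\<close>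
      suffices.\<close>
    then have big: "3 * e \<le> a1" using tri by auto
    then have "2 * a1 \<le> 3 * a3" using tri by auto
    then have "(2 * a1)\<^sup>2 \<le> (3 * a3)\<^sup>2" using nn by (intro power_mono) auto
    then have a3sq: "4 * a1\<^sup>2 \<le> 9 * a3\<^sup>2" by (simp add: power_mult_distrib)
    have "(3 * e)\<^sup>2 \<le> a1\<^sup>2" using big e(1) by (intro power_mono) auto
    then have esq: "9 * e\<^sup>2 \<le> a1\<^sup>2" by (simp add: power_mult_distrib)
    have "(nrm (\<lambda>\<omega>. V1 \<omega> - V3 \<omega>))\<^sup>2 \<le> e\<^sup>2" using e(3) nrm_nonneg by (intro power_mono) auto
    then have "a1\<^sup>2 + a3\<^sup>2 - 2 * ip V1 V3 \<le> e\<^sup>2"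
      using V by (simp add: nrm_square a_def ip_bilinear ip_commute[of V3 V1])
    then have "2 * a1\<^sup>2 \<le> 3 * ip V1 V3" using a3sq esq by linarith
    then have "2 * a1\<^sup>2 \<le> 3 * \<bar>ip V1 V3\<bar>" by linarith
    moreover have "0 < a1" using big e(1) by linarith
    ultimately have "2 * a1 \<le> 3 * (\<bar>ip V1 V3\<bar> / a1)"
      by (simp add: field_simps power2_eq_square)
    then have G: "2 * a1 \<le> 3 * \<Gamma>" using \<Gamma>13 by linarith
    have "min (1/4) (J / (32 * e\<^sup>2)) * (a3 + a4) \<le> 1/4 * (2 * (a1 + e))"
      using tri nn e(1) by (intro mult_mono) auto
    also have "\<dots> \<le> \<Gamma>" using G big e(1) by (simp add: field_simps)
    finally show ?thesis using G big e(1) by (auto simp: min_def)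
  qed
  then show "min (1/4) (J / (32 * e\<^sup>2)) * (nrm V3 + nrm V4) \<le> \<Gamma>" "min e (J / (4 * e)) \<le> \<Gamma>"
    by (auto simp: a_def)
qed

text \<open>In the bilinear expansion the squares of \<open>\<gamma>1\<close> and
  \<open>\<gamma>2\<close> are the signal. The errors are four products of two \<beta>s, eight
  products of a \<beta> with a \<gamma>, and \<open>ip \<gamma>1 \<gamma>2\<close> twice; as
  \<open>\<alpha> < 1\<close>, they add up to at most \<open>14 * r\<close>.\<close>

lemma mixed_covariance_ge:
  fixes \<beta>1 \<beta>2 \<beta>3 \<beta>4 \<gamma>1 \<gamma>2 :: "'a \<Rightarrow> real"
  assumes sq: "sq_integrable \<beta>1" "sq_integrable \<beta>2" "sq_integrable \<beta>3" "sq_integrable \<beta>4"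
      "sq_integrable \<gamma>1" "sq_integrable \<gamma>2"
    and \<beta>\<beta>: "\<bar>ip \<beta>1 \<beta>3\<bar> \<le> r" "\<bar>ip \<beta>1 \<beta>4\<bar> \<le> r" "\<bar>ip \<beta>2 \<beta>3\<bar> \<le> r" "\<bar>ip \<beta>2 \<beta>4\<bar> \<le> r"
    and \<beta>\<gamma>: "\<bar>ip \<beta>1 \<gamma>1\<bar> \<le> r" "\<bar>ip \<beta>2 \<gamma>1\<bar> \<le> r" "\<bar>ip \<beta>3 \<gamma>1\<bar> \<le> r" "\<bar>ip \<beta>4 \<gamma>1\<bar> \<le> r"
      "\<bar>ip \<beta>1 \<gamma>2\<bar> \<le> r" "\<bar>ip \<beta>2 \<gamma>2\<bar> \<le> r" "\<bar>ip \<beta>3 \<gamma>2\<bar> \<le> r" "\<bar>ip \<beta>4 \<gamma>2\<bar> \<le> r"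
    and \<gamma>\<gamma>: "\<bar>ip \<gamma>1 \<gamma>2\<bar> \<le> r" "g \<le> ip \<gamma>1 \<gamma>1" "g \<le> ip \<gamma>2 \<gamma>2"
    and \<alpha>: "0 < \<alpha>" "\<alpha> < 1"
  shows "2 * \<alpha>\<^sup>2 * g - 14 * r \<le>
    ip (\<lambda>\<omega>. (\<beta>1 \<omega> - \<beta>2 \<omega>) + \<alpha> * (\<gamma>1 \<omega> - \<gamma>2 \<omega>)) (\<lambda>\<omega>. (\<beta>3 \<omega> - \<beta>4 \<omega>) + \<alpha> * (\<gamma>1 \<omega> - \<gamma>2 \<omega>))"
proof -
  have r: "0 \<le> r" using \<gamma>\<gamma>(1) by linarith
  define A where "A = ip \<beta>1 \<beta>3 - ip \<beta>1 \<beta>4 - ip \<beta>2 \<beta>3 + ip \<beta>2 \<beta>4"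
  define B where "B = ip \<beta>1 \<gamma>1 - ip \<beta>1 \<gamma>2 - ip \<beta>2 \<gamma>1 + ip \<beta>2 \<gamma>2 + ip \<beta>3 \<gamma>1 - ip \<beta>3 \<gamma>2 - ip \<beta>4 \<gamma>1 + ip \<beta>4 \<gamma>2"
  define G where "G = ip \<gamma>1 \<gamma>1 + ip \<gamma>2 \<gamma>2 - 2 * ip \<gamma>1 \<gamma>2"
  have "ip (\<lambda>\<omega>. (\<beta>1 \<omega> - \<beta>2 \<omega>) + \<alpha> * (\<gamma>1 \<omega> - \<gamma>2 \<omega>)) (\<lambda>\<omega>. (\<beta>3 \<omega> - \<beta>4 \<omega>) + \<alpha> * (\<gamma>1 \<omega> - \<gamma>2 \<omega>))
      = A + \<alpha> * B + \<alpha>\<^sup>2 * G"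
    unfolding A_def B_def G_def using sq
    by (simp add: ip_bilinear ip_commute[of \<gamma>1 \<beta>3] ip_commute[of \<gamma>2 \<beta>3] ip_commute[of \<gamma>1 \<beta>4] ip_commute[of \<gamma>2 \<beta>4]
        ip_commute[of \<gamma>2 \<gamma>1] power2_eq_square algebra_simps)
  moreover have "- 4 * r \<le> A" unfolding A_def using \<beta>\<beta> by linarith
  moreover have "- (8 * r) \<le> \<alpha> * B"
  proof -
    have "\<bar>B\<bar> \<le> 8 * r" unfolding B_def using \<beta>\<gamma> by linarith
    then have "\<alpha> * \<bar>B\<bar> \<le> 1 * (8 * r)" using \<alpha> r by (intro mult_mono) auto
    moreover have "\<bar>\<alpha> * B\<bar> = \<alpha> * \<bar>B\<bar>" using \<alpha> by (simp add: abs_mult)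
    ultimately show ?thesis by linarith
  qed
  moreover have "2 * \<alpha>\<^sup>2 * g - 2 * r \<le> \<alpha>\<^sup>2 * G"
  proof -
    have "\<alpha>\<^sup>2 * (2 * g - 2 * r) \<le> \<alpha>\<^sup>2 * G"
      unfolding G_def using \<gamma>\<gamma> by (intro mult_left_mono) auto
    moreover have "\<alpha>\<^sup>2 * (2 * r) \<le> 1 * (2 * r)" using \<alpha> r by (intro mult_right_mono) (auto simp: power_le_one)
    ultimately show ?thesis by (simp add: right_diff_distrib mult_ac)
  qed
  ultimately show ?thesis by linarith
qed

end

section \<open>Covariances of increments of the bridge \<open>B\<close>\<close>

locale fractional_brownian_bridge = fractional_brownian_motion M H W
  for M :: "'a measure" and H W +
  fixes \<kappa> :: "real \<Rightarrow> real" and \<tau> C :: real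
  assumes \<kappa>_0: "\<kappa> 0 = 0" and C_nonneg: "0 \<le> C" and H_less_\<tau>: "H < \<tau>"
    and hoelder: "\<And>s t. 0 \<le> s \<Longrightarrow> s \<le> 1 \<Longrightarrow> 0 \<le> t \<Longrightarrow> t \<le> 1 \<Longrightarrow> \<bar>\<kappa> s - \<kappa> t\<bar> \<le> C * \<bar>s - t\<bar> powr \<tau>"
begin

definition dB :: "real \<Rightarrow> real \<Rightarrow> 'a \<Rightarrow> real" where
  "dB x p \<omega> = fbridge W \<kappa> (x + p) \<omega> - fbridge W \<kappa> x \<omega>"

lemma dB_eq: "dB x p = (\<lambda>\<omega>. dW x p \<omega> - (\<kappa> (x + p) - \<kappa> x) * W 1 \<omega>)"
  by (simp add: dB_def dW_def fbridge_def fun_eq_iff algebra_simps)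

lemma fbridge_gauss: "0 \<le> t \<Longrightarrow> fbridge W \<kappa> t \<in> gauss_span"
  unfolding fbridge_def[abs_def] by (intro gauss_span_diff gauss_span_scale gauss_span_W) auto

lemma dB_gauss: "0 \<le> x \<Longrightarrow> 0 \<le> p \<Longrightarrow> dB x p \<in> gauss_span"
  unfolding dB_def[abs_def] by (intro gauss_span_diff fbridge_gauss) auto

lemma \<kappa>_increment_le:
  assumes "0 \<le> x" "0 < p" "p \<le> m" "x + p \<le> 1"
  shows "\<bar>\<kappa> (x + p) - \<kappa> x\<bar> \<le> C * m powr \<tau>"
proof -
  have "\<bar>\<kappa> (x + p) - \<kappa> x\<bar> \<le> C * p powr \<tau>" using hoelder[of "x + p" x] assms by simp
  also have "\<dots> \<le> C * m powr \<tau>"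
    using assms H_pos H_less_\<tau> C_nonneg by (intro mult_left_mono powr_mono2) auto
  finally show ?thesis .
qed

lemma nrm_W_1: "nrm (W 1) = 1"
  by (simp add: nrm_def ip_W_self)

text \<open>The bound is stated with a common scale \<open>m\<close> because increments of length
  \<open>h\<close> and of length \<open>b * h\<close> are later compared at the larger of the two.
  The correction by \<kappa> is absorbed through
  \<open>m powr \<tau> \<le> m powr H\<close>.\<close>

lemma nrm_dB_le:
  assumes "0 \<le> x" "0 < p" "p \<le> m" "m \<le> 1" "x + p \<le> 1"
  shows "nrm (dB x p) \<le> (1 + C) * m powr H"
proof -
  have "nrm (dB x p) \<le> nrm (dW x p) + nrm (\<lambda>\<omega>. (\<kappa> (x + p) - \<kappa> x) * W 1 \<omega>)"
    unfolding dB_eq using assms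
    by (intro nrm_diff_le sq_integrable_scale sq_integrable_W gauss_span_sq_integrable dW_gauss) auto
  also have "\<dots> = p powr H + \<bar>\<kappa> (x + p) - \<kappa> x\<bar>"
    using assms by (simp add: nrm_dW nrm_scale nrm_W_1)
  also have "\<dots> \<le> m powr H + C * m powr \<tau>"
    using assms H_pos by (intro add_mono powr_mono2 \<kappa>_increment_le) auto
  also have "\<dots> \<le> m powr H + C * m powr H"
    using assms C_nonneg H_less_\<tau> by (intro add_left_mono mult_left_mono powr_mono') auto
  finally show ?thesis by (simp add: distrib_right)
qed

text \<open>The first term is the covariance of separated increments of \<open>W\<close>. The second
  comes from the correction by \<kappa>: two cross terms with \<open>W 1\<close> of size
  \<open>C * m powr \<tau> * m powr H\<close>, and the product of the two corrections, where one
  factor \<open>m powr \<tau>\<close> is relaxed to \<open>m powr H\<close>.\<close>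

definition cov_error :: "real \<Rightarrow> real \<Rightarrow> real" where
  "cov_error \<delta> m = \<delta> powr (2*H - 2) * m\<^sup>2 + (2 * C + C\<^sup>2) * m powr (\<tau> + H)"

lemma abs_ip_dB_le:
  assumes "0 \<le> x" "0 < p" "p \<le> m" "0 < q" "q \<le> m" "m \<le> 1" "0 < \<delta>" "x + p + \<delta> \<le> y" "y + q \<le> 1"
  shows "\<bar>ip (dB x p) (dB y q)\<bar> \<le> cov_error \<delta> m"
proof -
  define k l where "k = \<kappa> (x + p) - \<kappa> x" and "l = \<kappa> (y + q) - \<kappa> y"
  have m: "0 < m" using assms by linarith
  have k: "\<bar>k\<bar> \<le> C * m powr \<tau>" and l: "\<bar>l\<bar> \<le> C * m powr \<tau>"
    unfolding k_def l_def using assms by (auto intro!: \<kappa>_increment_le)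
  have sq: "sq_integrable (dW x p)" "sq_integrable (dW y q)" "sq_integrable (W 1)"
    using assms by (auto intro!: gauss_span_sq_integrable dW_gauss gauss_span_W)
  have "\<bar>ip (dW x p) (W 1)\<bar> \<le> p powr H" "\<bar>ip (dW y q) (W 1)\<bar> \<le> q powr H"
    using abs_ip_le[OF sq(1,3)] abs_ip_le[OF sq(2,3)] assms by (simp_all add: nrm_dW nrm_W_1)
  moreover have "p powr H \<le> m powr H" "q powr H \<le> m powr H"
    using assms H_pos by (auto intro!: powr_mono2)
  ultimately have w: "\<bar>ip (dW x p) (W 1)\<bar> \<le> m powr H" "\<bar>ip (dW y q) (W 1)\<bar> \<le> m powr H" by linarith+
  have "ip (dB x p) (dB y q) = ip (dW x p) (dW y q) - l * ip (dW x p) (W 1) - k * ip (dW y q) (W 1) + k * l"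
    unfolding dB_eq k_def[symmetric] l_def[symmetric] using sq
    by (simp add: ip_bilinear ip_W_self ip_commute[of "W 1" "dW y q"] algebra_simps)
  then have "\<bar>ip (dB x p) (dB y q)\<bar> \<le> \<bar>ip (dW x p) (dW y q)\<bar> + \<bar>l * ip (dW x p) (W 1)\<bar> + \<bar>k * ip (dW y q) (W 1)\<bar> + \<bar>k * l\<bar>"
    by linarith
  also have "\<bar>ip (dW x p) (dW y q)\<bar> \<le> \<delta> powr (2*H - 2) * m\<^sup>2"
  proof -
    have "\<bar>ip (dW x p) (dW y q)\<bar> \<le> \<delta> powr (2*H - 2) * p * q"
      using assms by (intro abs_ip_dW_le) auto
    also have "\<dots> \<le> \<delta> powr (2*H - 2) * m * m"
      using assms by (intro mult_mono) auto
    finally show ?thesis by (simp add: power2_eq_square mult.assoc)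
  qed
  also have "\<bar>l * ip (dW x p) (W 1)\<bar> \<le> (C * m powr \<tau>) * m powr H"
    unfolding abs_mult using l w C_nonneg by (intro mult_mono) auto
  also have "\<bar>k * ip (dW y q) (W 1)\<bar> \<le> (C * m powr \<tau>) * m powr H"
    unfolding abs_mult using k w C_nonneg by (intro mult_mono) auto
  also have "\<bar>k * l\<bar> \<le> (C * m powr \<tau>) * (C * m powr H)"
  proof -
    have "\<bar>l\<bar> \<le> C * m powr H"
      by (rule order_trans[OF l]) (use assms m C_nonneg H_less_\<tau> in \<open>auto intro!: mult_left_mono powr_mono'\<close>)
    then show ?thesis unfolding abs_mult using k C_nonneg by (intro mult_mono) auto
  qed
  finally show ?thesis by (simp add: cov_error_def powr_add algebra_simps power2_eq_square)
qed

lemma ip_dB_self_ge: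
  assumes "0 \<le> x" "0 < m" "m \<le> 1" "x + m \<le> 1"
  shows "m powr (2*H) - 2 * C * m powr (\<tau> + H) \<le> ip (dB x m) (dB x m)"
proof -
  define k where "k = \<kappa> (x + m) - \<kappa> x"
  have k: "\<bar>k\<bar> \<le> C * m powr \<tau>"
    unfolding k_def using assms by (auto intro!: \<kappa>_increment_le)
  have sq: "sq_integrable (dW x m)" "sq_integrable (W 1)"
    using assms by (auto intro!: gauss_span_sq_integrable dW_gauss gauss_span_W)
  have w: "\<bar>ip (dW x m) (W 1)\<bar> \<le> m powr H"
    using abs_ip_le[OF sq] assms by (simp add: nrm_dW nrm_W_1)
  have "\<bar>k * ip (dW x m) (W 1)\<bar> \<le> (C * m powr \<tau>) * m powr H"
    unfolding abs_mult using k w C_nonneg by (intro mult_mono) auto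
  moreover have "ip (dB x m) (dB x m) = m powr (2*H) - 2 * (k * ip (dW x m) (W 1)) + k\<^sup>2"
    unfolding dB_eq k_def[symmetric] using sq assms
    by (simp add: ip_bilinear ip_W_self ip_dW_self ip_commute[of "W 1" "dW x m"] power2_eq_square algebra_simps)
  moreover have "0 \<le> k\<^sup>2" by simp
  moreover have "2 * C * m powr (\<tau> + H) = 2 * ((C * m powr \<tau>) * m powr H)" by (simp add: powr_add)
  ultimately show ?thesis by linarith
qed

text \<open>After division by \<open>m powr (2*H)\<close> the exponents left over are
  \<open>2 - 2*H\<close> and \<open>\<tau> - H\<close>, both positive. This is where the regularity
  of \<kappa> beyond \<open>H\<close> enters.\<close>

lemma cov_error_small:
  assumes "0 < c" "0 < \<delta>"
  shows "eventually (\<lambda>m. cov_error \<delta> m \<le> c * m powr (2*H)) (at_right 0)"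
proof -
  have "((\<lambda>m. \<delta> powr (2*H - 2) * m powr (2 - 2*H) + (2 * C + C\<^sup>2) * m powr (\<tau> - H)) \<longlongrightarrow>
      \<delta> powr (2*H - 2) * 0 + (2 * C + C\<^sup>2) * 0) (at_right 0)"
    using H_less_1 H_less_\<tau> by (intro tendsto_intros tendsto_zero_powrI[where b="2 - 2*H"] tendsto_zero_powrI[where b="\<tau> - H"])
      (auto intro!: tendsto_intros eventually_at_right_less simp: eventually_at_filter)
  then have "eventually (\<lambda>m. \<delta> powr (2*H - 2) * m powr (2 - 2*H) + (2 * C + C\<^sup>2) * m powr (\<tau> - H) < c) (at_right 0)"
    using assms(1) by (auto dest: order_tendstoD(2))
  then show ?thesis
    using eventually_at_right_less
  proof eventually_elim
    case (elim m)
    have "m\<^sup>2 = m powr (2 - 2*H) * m powr (2*H)"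
      using elim(2) by (simp add: powr_add[symmetric])
    moreover have "m powr (\<tau> + H) = m powr (\<tau> - H) * m powr (2*H)"
      by (simp add: powr_add[symmetric] add.commute)
    ultimately have "cov_error \<delta> m = (\<delta> powr (2*H - 2) * m powr (2 - 2*H) + (2 * C + C\<^sup>2) * m powr (\<tau> - H)) * m powr (2*H)"
      by (simp add: cov_error_def algebra_simps)
    also have "\<dots> \<le> c * m powr (2*H)"
      using elim(1) by (intro mult_right_mono) auto
    finally show ?case .
  qed
qed

end

section \<open>Increments of the Wiener--Weierstrass bridge\<close>

text \<open>With \<open>u = 1/b\<close>, \<open>w = b * s\<close> and \<open>s = u * w\<close>, the
  path is read at \<open>s < w < s + u\<^sup>2 < s + u < w + u < s + u + u\<^sup>2\<close>.
  Consecutive places are at least \<open>u ^ 4\<close> apart, and the last one leaves room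
  \<open>u ^ 4\<close> before 1. The second gap is the delicate one: it exceeds \<open>u ^ 4\<close>
  by at least the square \<open>u\<^sup>2 * (1 - u)\<^sup>2\<close>.\<close>

lemma grid_points_separated:
  fixes u w :: real
  assumes u: "0 < u" "u \<le> 1 / 2" and w: "u ^ 3 \<le> w" "w \<le> 2 * u ^ 3"
  shows "u ^ 4 \<le> w - u * w" "u ^ 4 \<le> u * w + u\<^sup>2 - w" "u ^ 4 \<le> u - u\<^sup>2" "u * w + u + u\<^sup>2 + u ^ 4 \<le> 1"
proof -
  have "u ^ 3 * u \<le> w * (1 - u)" using u w by (intro mult_mono) auto
  then show "u ^ 4 \<le> w - u * w" by (simp add: power4_eq_xxxx power3_eq_cube algebra_simps)
  have "w * (1 - u) \<le> 2 * u ^ 3 * (1 - u)" using u w by (intro mult_right_mono) auto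
  moreover have "0 \<le> u\<^sup>2 * (1 - u)\<^sup>2" by simp
  moreover have "u\<^sup>2 * (1 - u)\<^sup>2 = u\<^sup>2 - 2 * u ^ 3 * (1 - u) - u ^ 4"
    by (simp add: power2_eq_square power3_eq_cube power4_eq_xxxx algebra_simps)
  moreover have "w * (1 - u) = w - u * w" by (simp add: algebra_simps)
  ultimately show "u ^ 4 \<le> u * w + u\<^sup>2 - w" by linarith
  have u2: "u\<^sup>2 \<le> 1 / 4" using power_mono[OF u(2), of 2] u by (simp add: power2_eq_square)
  have u4: "u ^ 4 \<le> 1 / 16" using power_mono[OF u(2), of 4] u by (simp add: power4_eq_xxxx)
  have "u ^ 4 \<le> u\<^sup>2" using u by (intro power_decreasing) auto
  moreover have "u\<^sup>2 \<le> u - u\<^sup>2" using mult_right_mono[OF u(2), of u] u by (simp add: power2_eq_square)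
  ultimately show "u ^ 4 \<le> u - u\<^sup>2" by linarith
  have "u * w \<le> u * (2 * u ^ 3)" using u w by (intro mult_left_mono) auto
  also have "\<dots> = 2 * u ^ 4" by (simp add: power4_eq_xxxx power3_eq_cube)
  finally show "u * w + u + u\<^sup>2 + u ^ 4 \<le> 1" using u2 u4 u(2) by linarith
qed

locale wiener_weierstrass_bridge = fractional_brownian_bridge M H W \<kappa> \<tau> C
  for M :: "'a measure" and H W \<kappa> \<tau> C +
  fixes \<alpha> :: real and b :: nat
  assumes \<alpha>_pos: "0 < \<alpha>" and \<alpha>_less_1: "\<alpha> < 1" and b_ge_2: "2 \<le> b"
begin

abbreviation X :: "real \<Rightarrow> 'a \<Rightarrow> real" where
  "X \<equiv> wwbridge W \<kappa> \<alpha> b"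

lemma fbridge_0: "\<omega> \<in> space M \<Longrightarrow> fbridge W \<kappa> 0 \<omega> = 0"
  using fbm \<kappa>_0 by (simp add: fbridge_def fbm_def)

text \<open>From level \<open>N\<close> on the argument is an integer and \<open>B\<close> vanishes
  at 0, so the series is a finite sum. Values on the grid therefore lie in \<open>gauss_span\<close>
  without any limit of Gaussian variables.\<close>

lemma wwbridge_grid:
  assumes "\<omega> \<in> space M"
  shows "X (real q / real b ^ N) \<omega> = (\<Sum>n<N. \<alpha> ^ n * fbridge W \<kappa> (frac (real b ^ n * (real q / real b ^ N))) \<omega>)"
  unfolding wwbridge_def
proof (rule suminf_finite)
  fix n assume "n \<notin> {..<N}"
  then obtain d where "n = N + d" by (auto simp: not_less dest: le_Suc_ex)
  then have "real b ^ n * (real q / real b ^ N) = real (b ^ d * q)"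
    using b_ge_2 by (simp add: power_add)
  then have "frac (real b ^ n * (real q / real b ^ N)) = 0"
    by (simp only: frac_eq_0_iff Ints_of_nat)
  with fbridge_0[OF assms] show "\<alpha> ^ n * fbridge W \<kappa> (frac (real b ^ n * (real q / real b ^ N))) \<omega> = 0"
    by (simp only: mult_zero_right)
qed simp

lemma wwbridge_grid_gauss: "X (real q / real b ^ N) \<in> gauss_span"
  by (rule gauss_span_cong[OF gauss_span_sum wwbridge_grid])
     (auto intro!: gauss_span_scale fbridge_gauss)

text \<open>Level 2 is the first one that is invariant under shifts by multiples of
  \<open>1 / b\<^sup>2\<close>, the shifts between the four increments.\<close>

definition coarse_part :: "nat \<Rightarrow> real \<Rightarrow> 'a \<Rightarrow> real" where
  "coarse_part N t \<omega> = (\<Sum>n\<in>{2..<N}. \<alpha> ^ n * fbridge W \<kappa> (frac (real b ^ n * t)) \<omega>)"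

lemma wwbridge_grid_split:
  assumes "\<omega> \<in> space M" and t: "t = real q / real b ^ (k + 2)" and z: "z = real j / (real b)\<^sup>2"
  shows "X (t + z) \<omega> = fbridge W \<kappa> (frac (t + z)) \<omega> + \<alpha> * fbridge W \<kappa> (frac (real b * (t + z))) \<omega> + coarse_part (k + 2) t \<omega>"
proof -
  have b0: "real b \<noteq> 0" using b_ge_2 by auto
  have tz: "t + z = real (q + j * b ^ k) / real b ^ (k + 2)"
    unfolding t z using b0 by (simp add: power_add power2_eq_square field_simps)
  define f where "f n = \<alpha> ^ n * fbridge W \<kappa> (frac (real b ^ n * (t + z))) \<omega>" for n
  have "X (t + z) \<omega> = (\<Sum>n<k + 2. f n)"
    unfolding f_def tz by (rule wwbridge_grid[OF assms(1)])
  also have "{..<k + 2} = {0, 1} \<union> {2..<k + 2}" by auto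
  also have "sum f ({0, 1} \<union> {2..<k + 2}) = f 0 + f 1 + sum f {2..<k + 2}"
    by (subst sum.union_disjoint) auto
  also have "sum f {2..<k + 2} = coarse_part (k + 2) t \<omega>"
    unfolding coarse_part_def
  proof (rule sum.cong)
    fix n assume "n \<in> {2..<k + 2}"
    then obtain d where "n = 2 + d" by (auto dest: le_Suc_ex)
    then have "real b ^ n * z = real (b ^ d * j)"
      unfolding z using b0 by (simp add: power_add power2_eq_square)
    then have "frac (real b ^ n * (t + z)) = frac (real b ^ n * t)"
      unfolding distrib_left by (simp only: frac_add_int_right Ints_of_nat)
    then show "f n = \<alpha> ^ n * fbridge W \<kappa> (frac (real b ^ n * t)) \<omega>" by (simp add: f_def)
  qed simp
  finally show ?thesis by (simp add: f_def)
qed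

text \<open>The cast encloses the power so that the grid points have the shape
  \<open>real q / real n\<close>, as in the elementary integrals. The mesh
  \<open>b ^ (k + 4)\<close> leaves \<open>b ^ k\<close> cells starting between
  \<open>1 / b ^ 4\<close> and \<open>2 / b ^ 4\<close>.\<close>

definition dX :: "nat \<Rightarrow> nat \<Rightarrow> 'a \<Rightarrow> real" where
  "dX k q \<omega> = X (real (Suc q) / real (b ^ (k + 4))) \<omega> - X (real q / real (b ^ (k + 4))) \<omega>"

lemma dX_gauss: "dX k q \<in> gauss_span"
  unfolding dX_def[abs_def] of_nat_power by (intro gauss_span_diff wwbridge_grid_gauss)

text \<open>The number \<open>y\<close> represents \<open>b * (s + z)\<close> modulo 1. The
  assumptions on \<open>y\<close> and \<open>s + z\<close> keep both intervals from reaching an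
  integer, so that the fractional part moves by the full length of the increment.\<close>

lemma dX_split:
  assumes \<omega>: "\<omega> \<in> space M" and h: "h = 1 / real b ^ (k + 4)" and s: "s = real i / real b ^ (k + 4)"
    and q: "q = i + j * b ^ (k + 2)" and z: "z = real j / (real b)\<^sup>2"
    and fine: "0 \<le> s + z" "s + z + h < 1" and level1: "y - real b * (s + z) \<in> \<int>" "0 \<le> y" "y + real b * h < 1"
  shows "dX k q \<omega> = dB (s + z) h \<omega> + \<alpha> * dB y (real b * h) \<omega>
    + (coarse_part (k + 4) (s + h) \<omega> - coarse_part (k + 4) s \<omega>)"
proof -
  have b0: "0 < real b" using b_ge_2 by auto
  have h0: "0 < h" unfolding h using b0 by simp
  then have bh0: "0 < real b * h" using b0 by simp
  have e1: "real q / real (b ^ (k + 4)) = s + z" and e2: "real (Suc q) / real (b ^ (k + 4)) = (s + h) + z"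
    unfolding q s z h using b0 by (simp_all add: power_add power2_eq_square power4_eq_xxxx field_simps)
  have sh: "s + h = real (Suc i) / real b ^ (k + 4)" unfolding s h by (simp add: add_divide_distrib)
  have kk: "k + 2 + 2 = k + 4" by simp
  have "frac (s + z) = s + z"
    using fine h0 by (simp add: frac_eq)
  moreover have "frac (real b * (s + z)) = y"
  proof (subst frac_unique_iff, intro conjI)
    have "real b * (s + z) - y = - (y - real b * (s + z))" by simp
    then show "real b * (s + z) - y \<in> \<int>" using level1(1) by (simp only: Ints_minus)
  qed (use level1 bh0 in auto)
  ultimately have X1: "X (s + z) \<omega> = fbridge W \<kappa> (s + z) \<omega> + \<alpha> * fbridge W \<kappa> y \<omega> + coarse_part (k + 4) s \<omega>"
    using wwbridge_grid_split[OF \<omega>, of s i "k + 2" z j, unfolded kk, OF s z] by simp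
  have "frac (s + h + z) = s + z + h"
    using fine h0 by (simp add: frac_eq add_ac)
  moreover have "frac (real b * (s + h + z)) = y + real b * h"
  proof (subst frac_unique_iff, intro conjI)
    have "real b * (s + h + z) - (y + real b * h) = - (y - real b * (s + z))" by (simp add: algebra_simps)
    then show "real b * (s + h + z) - (y + real b * h) \<in> \<int>" using level1(1) by (simp only: Ints_minus)
  qed (use level1 bh0 in auto)
  ultimately have X2: "X (s + h + z) \<omega> = fbridge W \<kappa> (s + z + h) \<omega> + \<alpha> * fbridge W \<kappa> (y + real b * h) \<omega> + coarse_part (k + 4) (s + h) \<omega>"
    using wwbridge_grid_split[OF \<omega>, of "s + h" "Suc i" "k + 2" z j, unfolded kk, OF sh z] by simp
  show ?thesis
    unfolding dX_def e1 e2 dB_def X1 X2 by (simp add: algebra_simps)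
qed

text \<open>The second pair of increments repeats the level-one terms \<open>\<gamma>1\<close> and \<open>\<gamma>2\<close> of the first pair,
  whereas all coarser levels coincide and cancel in \<open>V1 - V2\<close> and \<open>V3 - V4\<close>.\<close>

lemma dX_correlations:
  assumes i: "b ^ k \<le> i" "i < 2 * b ^ k" and m: "m = 1 / real b ^ (k + 3)" "m \<le> 1 / (2 * real b ^ 4)"
    and small: "16 * cov_error (1 / (2 * real b ^ 4)) m \<le> \<alpha>\<^sup>2 * m powr (2*H)"
    and V: "V1 = dX k i" "V2 = dX k (i + b ^ (k + 2))" "V3 = dX k (i + b ^ (k + 3))" "V4 = dX k (i + (b ^ (k + 3) + b ^ (k + 2)))"
    and \<Gamma>: "\<Gamma> = \<bar>ip V1 V3\<bar> / nrm V1 + \<bar>ip V2 V3\<bar> / nrm V2 + (\<bar>ip V1 V4\<bar> / nrm V1 + \<bar>ip V2 V4\<bar> / nrm V2)"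
  shows "min (1/4) (\<alpha>\<^sup>2 / (512 * (1 + C)\<^sup>2)) * (nrm V3 + nrm V4) \<le> \<Gamma>"
    "min (4 * (1 + C)) (\<alpha>\<^sup>2 / (16 * (1 + C))) * m powr H \<le> \<Gamma>"
proof -
  \<comment> \<open>Position and length are \<open>s\<close>, \<open>h\<close> at level zero and
    \<open>w\<close>, \<open>m\<close> at level one. The gap \<open>u ^ 4\<close> between places
    equals \<open>2 * \<delta>\<close>; lengths are at most \<open>\<delta>\<close>, so intervals
    remain \<open>\<delta>\<close> apart.\<close>
  define B u s w h \<delta> where "B = real b" and "u = 1 / B" and "s = real i / B ^ (k + 4)" and "w = B * s"
    and "h = 1 / B ^ (k + 4)" and "\<delta> = 1 / (2 * B ^ 4)"
  have B: "2 \<le> B" using b_ge_2 by (simp add: B_def)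
  have u: "0 < u" "u \<le> 1 / 2" using B by (auto simp: u_def field_simps)
  have Bu: "B * u = 1" using B by (simp add: u_def)
  have m0: "0 < m" unfolding m(1) using B by (simp add: B_def)
  have Bh: "B * h = m" and hm: "h = u * m" unfolding h_def m(1) u_def B_def using B
    by (simp_all add: power_add power3_eq_cube power4_eq_xxxx B_def)
  have h0: "0 < h" using hm u m0 by simp
  have hlem: "h \<le> m" using hm mult_right_mono[OF u(2), of m] m0 by simp
  have \<delta>u: "2 * \<delta> = u ^ 4" by (simp add: \<delta>_def u_def power_divide)
  have m\<delta>: "m \<le> \<delta>" using m(2) by (simp add: \<delta>_def B_def)
  have \<delta>0: "0 < \<delta>" using m\<delta> m0 by linarith
  have suw: "s = u * w" using Bu by (simp add: w_def mult.assoc[symmetric] mult.commute[of u])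
  have w1: "u ^ 3 \<le> w"
  proof -
    have "u ^ 3 = B * (real (b ^ k) / B ^ (k + 4))"
      using B by (simp add: u_def B_def power_add power_divide power3_eq_cube power4_eq_xxxx)
    also have "\<dots> \<le> w" unfolding w_def s_def using i(1) B
      by (intro mult_left_mono divide_right_mono) auto
    finally show ?thesis .
  qed
  have w2: "w \<le> 2 * u ^ 3"
  proof -
    have "w \<le> B * (real (2 * b ^ k) / B ^ (k + 4))" unfolding w_def s_def using i(2) B
      by (intro mult_left_mono divide_right_mono) (auto simp del: of_nat_mult of_nat_power)
    also have "\<dots> = 2 * u ^ 3"
      using B by (simp add: u_def B_def power_add power_divide power3_eq_cube power4_eq_xxxx)
    finally show ?thesis .
  qed
  note sep = grid_points_separated[OF u w1 w2, folded suw \<delta>u]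
  have s0: "0 \<le> s" unfolding s_def using B by simp
  have w0: "0 \<le> w" unfolding w_def using s0 B by simp
  have u2: "0 < u\<^sup>2" using u by simp
  have "m \<le> 1" using m\<delta> sep(4) u s0 u2 \<delta>0 by linarith
  define \<rho> where "\<rho> \<omega> = coarse_part (k + 4) (s + h) \<omega> - coarse_part (k + 4) s \<omega>" for \<omega>
  define \<beta>1 \<beta>2 \<beta>3 \<beta>4 \<gamma>1 \<gamma>2 where "\<beta>1 = dB s h" and "\<beta>2 = dB (s + u\<^sup>2) h" and "\<beta>3 = dB (s + u) h"
    and "\<beta>4 = dB (s + (u + u\<^sup>2)) h" and "\<gamma>1 = dB w m" and "\<gamma>2 = dB (w + u) m"
  note d = \<beta>1_def \<beta>2_def \<beta>3_def \<beta>4_def \<gamma>1_def \<gamma>2_def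
  have zs: "0 = real 0 / (real b)\<^sup>2" "u\<^sup>2 = real 1 / (real b)\<^sup>2" "u = real b / (real b)\<^sup>2" "u + u\<^sup>2 = real (b + 1) / (real b)\<^sup>2"
    using B by (simp_all add: u_def B_def power2_eq_square field_simps)
  have qs: "i = i + 0 * b ^ (k + 2)" "i + b ^ (k + 2) = i + 1 * b ^ (k + 2)"
    "i + b ^ (k + 3) = i + b * b ^ (k + 2)" "i + (b ^ (k + 3) + b ^ (k + 2)) = i + (b + 1) * b ^ (k + 2)"
    by (simp_all add: power_add power3_eq_cube power2_eq_square algebra_simps)
  \<comment> \<open>The shift by \<open>u\<close> is a full period at level one, which is why the
    same \<open>\<gamma>1\<close> and \<open>\<gamma>2\<close> reappear; the shift by
    \<open>u\<^sup>2\<close> becomes \<open>u\<close> and separates them.\<close>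
  have Bz: "B * (s + 0) = w" "B * (s + u\<^sup>2) = w + u" "B * (s + u) = w + 1" "B * (s + (u + u\<^sup>2)) = w + u + 1"
    using Bu by (simp_all add: w_def distrib_left power2_eq_square mult.assoc[symmetric])
  have V1: "V1 \<omega> = \<beta>1 \<omega> + \<alpha> * \<gamma>1 \<omega> + \<rho> \<omega>" if "\<omega> \<in> space M" for \<omega>
    using dX_split[OF that h_def[unfolded B_def] s_def[unfolded B_def] qs(1) zs(1), folded B_def, of w, unfolded Bz Bh]
      s0 w0 sep u m\<delta> hlem h0 m0 \<delta>0 u2 by (simp add: V d \<rho>_def)
  have V2: "V2 \<omega> = \<beta>2 \<omega> + \<alpha> * \<gamma>2 \<omega> + \<rho> \<omega>" if "\<omega> \<in> space M" for \<omega>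
    using dX_split[OF that h_def[unfolded B_def] s_def[unfolded B_def] qs(2) zs(2), folded B_def, of "w + u", unfolded Bz Bh]
      s0 w0 sep u m\<delta> hlem h0 m0 \<delta>0 u2 by (simp add: V d \<rho>_def)
  have V3: "V3 \<omega> = \<beta>3 \<omega> + \<alpha> * \<gamma>1 \<omega> + \<rho> \<omega>" if "\<omega> \<in> space M" for \<omega>
    using dX_split[OF that h_def[unfolded B_def] s_def[unfolded B_def] qs(3) zs(3), folded B_def, of w, unfolded Bz Bh]
      s0 w0 sep u m\<delta> hlem h0 m0 \<delta>0 u2 by (simp add: V d \<rho>_def)
  have V4: "V4 \<omega> = \<beta>4 \<omega> + \<alpha> * \<gamma>2 \<omega> + \<rho> \<omega>" if "\<omega> \<in> space M" for \<omega>
    using dX_split[OF that h_def[unfolded B_def] s_def[unfolded B_def] qs(4) zs(4), folded B_def, of "w + u", unfolded Bz Bh]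
      s0 w0 sep u m\<delta> hlem h0 m0 \<delta>0 u2 by (simp add: V d \<rho>_def)
  have sq: "sq_integrable \<beta>1" "sq_integrable \<beta>2" "sq_integrable \<beta>3" "sq_integrable \<beta>4"
      "sq_integrable \<gamma>1" "sq_integrable \<gamma>2"
    unfolding d using s0 w0 u h0 m0 u2 by (auto intro!: gauss_span_sq_integrable dB_gauss)
  define r where "r = cov_error \<delta> m"
  have cov: "\<bar>ip (dB x p) (dB y q)\<bar> \<le> r"
    if "0 \<le> x" "p \<in> {h, m}" "q \<in> {h, m}" "x + 2 * \<delta> \<le> y" "y + m \<le> 1" for x y p q
    unfolding r_def using that \<open>m \<le> 1\<close> m\<delta> hlem h0 m0 \<delta>0 by (intro abs_ip_dB_le) auto
  have cov': "\<bar>ip (dB y q) (dB x p)\<bar> \<le> r"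
    if "0 \<le> x" "p \<in> {h, m}" "q \<in> {h, m}" "x + 2 * \<delta> \<le> y" "y + m \<le> 1" for x y p q
    using cov[OF that] by (simp add: ip_commute)
  define g where "g = m powr (2*H) - 2 * C * m powr (\<tau> + H)"
  have "2 * \<alpha>\<^sup>2 * g - 14 * r \<le>
    ip (\<lambda>\<omega>. (\<beta>1 \<omega> - \<beta>2 \<omega>) + \<alpha> * (\<gamma>1 \<omega> - \<gamma>2 \<omega>)) (\<lambda>\<omega>. (\<beta>3 \<omega> - \<beta>4 \<omega>) + \<alpha> * (\<gamma>1 \<omega> - \<gamma>2 \<omega>))"
  proof (rule mixed_covariance_ge[OF sq])
    show "g \<le> ip \<gamma>1 \<gamma>1" "g \<le> ip \<gamma>2 \<gamma>2"
      unfolding g_def d using w0 u m0 \<open>m \<le> 1\<close> sep m\<delta> u2 s0 \<delta>0 by (auto intro!: ip_dB_self_ge)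
    show "\<bar>ip \<beta>1 \<beta>3\<bar> \<le> r" "\<bar>ip \<beta>1 \<beta>4\<bar> \<le> r" "\<bar>ip \<beta>2 \<beta>3\<bar> \<le> r" "\<bar>ip \<beta>2 \<beta>4\<bar> \<le> r"
      "\<bar>ip \<beta>1 \<gamma>1\<bar> \<le> r" "\<bar>ip \<beta>1 \<gamma>2\<bar> \<le> r" "\<bar>ip \<beta>2 \<gamma>2\<bar> \<le> r" "\<bar>ip \<beta>3 \<gamma>2\<bar> \<le> r" "\<bar>ip \<gamma>1 \<gamma>2\<bar> \<le> r"
      unfolding d using s0 w0 u sep m\<delta> u2 m0 \<delta>0 by (auto intro!: cov)
    show "\<bar>ip \<beta>2 \<gamma>1\<bar> \<le> r" "\<bar>ip \<beta>3 \<gamma>1\<bar> \<le> r" "\<bar>ip \<beta>4 \<gamma>1\<bar> \<le> r" "\<bar>ip \<beta>4 \<gamma>2\<bar> \<le> r"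
      unfolding d using s0 w0 u sep m\<delta> u2 m0 \<delta>0 by (auto intro!: cov')
  qed (rule \<alpha>_pos \<alpha>_less_1)+
  also have "\<dots> = ip (\<lambda>\<omega>. V1 \<omega> - V2 \<omega>) (\<lambda>\<omega>. V3 \<omega> - V4 \<omega>)"
    unfolding ip_def by (intro Bochner_Integration.integral_cong) (auto simp: V1 V2 V3 V4 algebra_simps)
  finally have J': "2 * \<alpha>\<^sup>2 * g - 14 * r \<le> ip (\<lambda>\<omega>. V1 \<omega> - V2 \<omega>) (\<lambda>\<omega>. V3 \<omega> - V4 \<omega>)" .
  \<comment> \<open>Replacing \<open>g\<close> by \<open>m powr (2*H)\<close> costs at most another
    \<open>2 * r\<close>. This explains the factor 16 in \<open>small\<close>: one half of the
    signal pays for all errors.\<close>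
  have "\<alpha>\<^sup>2 * m powr (2*H) \<le> 2 * \<alpha>\<^sup>2 * g - 14 * r"
  proof -
    have "2 * C * m powr (\<tau> + H) \<le> r"
      unfolding r_def cov_error_def by (simp add: distrib_right)
    then have "\<alpha>\<^sup>2 * (2 * C * m powr (\<tau> + H)) \<le> 1 * r"
      using \<alpha>_pos \<alpha>_less_1 C_nonneg by (intro mult_mono) (auto simp: power_le_one)
    moreover have "16 * r \<le> \<alpha>\<^sup>2 * m powr (2*H)" using small by (simp add: r_def \<delta>_def B_def)
    ultimately show ?thesis by (simp add: g_def right_diff_distrib)
  qed
  with J' have J: "\<alpha>\<^sup>2 * m powr (2*H) \<le> ip (\<lambda>\<omega>. V1 \<omega> - V2 \<omega>) (\<lambda>\<omega>. V3 \<omega> - V4 \<omega>)" by linarith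
  \<comment> \<open>A difference of two of the variables consists of four bridge increments, two of
    them weighted by \<open>\<alpha> < 1\<close>; the common \<open>\<rho>\<close> drops out. Since
    \<open>e\<^sup>2\<close> and the covariance bound are both multiples of
    \<open>m powr (2*H)\<close>, the resulting constants do not depend on \<open>k\<close>.\<close>
  define e where "e = 4 * (1 + C) * m powr H"
  have nb: "nrm \<beta>1 \<le> (1 + C) * m powr H" "nrm \<beta>2 \<le> (1 + C) * m powr H" "nrm \<beta>3 \<le> (1 + C) * m powr H"
    "nrm \<beta>4 \<le> (1 + C) * m powr H" "nrm \<gamma>1 \<le> (1 + C) * m powr H" "nrm \<gamma>2 \<le> (1 + C) * m powr H"
    unfolding d using s0 w0 u sep m\<delta> u2 m0 \<delta>0 hlem h0 \<open>m \<le> 1\<close> by (auto intro!: nrm_dB_le)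
  have diff_le: "nrm (\<lambda>\<omega>. U \<omega> - V \<omega>) \<le> e"
    if U: "\<And>\<omega>. \<omega> \<in> space M \<Longrightarrow> U \<omega> = \<beta> \<omega> + \<alpha> * \<gamma> \<omega> + \<rho> \<omega>" and V: "\<And>\<omega>. \<omega> \<in> space M \<Longrightarrow> V \<omega> = \<beta>' \<omega> + \<alpha> * \<gamma>' \<omega> + \<rho> \<omega>"
      and s4: "sq_integrable \<beta>" "sq_integrable \<beta>'" "sq_integrable \<gamma>" "sq_integrable \<gamma>'"
      and n4: "nrm \<beta> \<le> (1 + C) * m powr H" "nrm \<beta>' \<le> (1 + C) * m powr H" "nrm \<gamma> \<le> (1 + C) * m powr H" "nrm \<gamma>' \<le> (1 + C) * m powr H"
    for U V \<beta> \<beta>' \<gamma> \<gamma>'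
  proof -
    have "nrm (\<lambda>\<omega>. U \<omega> - V \<omega>) = nrm (\<lambda>\<omega>. (\<beta> \<omega> - \<beta>' \<omega>) + \<alpha> * (\<gamma> \<omega> - \<gamma>' \<omega>))"
      unfolding nrm_def ip_def
      by (intro arg_cong[where f=sqrt] Bochner_Integration.integral_cong) (auto simp: U V algebra_simps)
    also have "\<dots> \<le> nrm (\<lambda>\<omega>. \<beta> \<omega> - \<beta>' \<omega>) + \<bar>\<alpha>\<bar> * nrm (\<lambda>\<omega>. \<gamma> \<omega> - \<gamma>' \<omega>)"
      unfolding nrm_scale[symmetric] by (intro nrm_add_le sq_integrable_scale sq_integrable_diff s4)
    also have "\<dots> \<le> nrm (\<lambda>\<omega>. \<beta> \<omega> - \<beta>' \<omega>) + 1 * nrm (\<lambda>\<omega>. \<gamma> \<omega> - \<gamma>' \<omega>)"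
      using \<alpha>_pos \<alpha>_less_1 by (intro add_left_mono mult_right_mono nrm_nonneg) auto
    also have "\<dots> \<le> (nrm \<beta> + nrm \<beta>') + 1 * (nrm \<gamma> + nrm \<gamma>')"
      by (intro add_mono mult_left_mono nrm_diff_le s4) auto
    also have "\<dots> \<le> ((1 + C) * m powr H + (1 + C) * m powr H) + 1 * ((1 + C) * m powr H + (1 + C) * m powr H)"
      by (intro add_mono mult_left_mono n4) auto
    also have "\<dots> = e" by (simp add: e_def)
    finally show ?thesis .
  qed
  have VS: "sq_integrable V1" "sq_integrable V2" "sq_integrable V3" "sq_integrable V4"
    unfolding V by (auto intro!: gauss_span_sq_integrable dX_gauss)
  have e0: "0 < e" using C_nonneg m0 by (simp add: e_def)
  have J0: "0 < \<alpha>\<^sup>2 * m powr (2*H)" using \<alpha>_pos m0 by simp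
  have e12: "nrm (\<lambda>\<omega>. V1 \<omega> - V2 \<omega>) \<le> e" by (rule diff_le[OF V1 V2]) (use sq nb in auto)
  have e13: "nrm (\<lambda>\<omega>. V1 \<omega> - V3 \<omega>) \<le> e" by (rule diff_le[OF V1 V3]) (use sq nb in auto)
  have e14: "nrm (\<lambda>\<omega>. V1 \<omega> - V4 \<omega>) \<le> e" by (rule diff_le[OF V1 V4]) (use sq nb in auto)
  note dich = correlation_dichotomy[OF VS e0 e12 e13 e14 J0 J \<Gamma>]
  have mm: "m powr (2*H) = m powr H * m powr H" by (simp add: powr_add[symmetric])
  have mH: "0 < m powr H" using m0 by simp
  have "\<alpha>\<^sup>2 * m powr (2*H) / (32 * e\<^sup>2) = \<alpha>\<^sup>2 / (512 * (1 + C)\<^sup>2)"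
  proof -
    have "a * (x * x) / (32 * (4 * c * x)\<^sup>2) = a / (512 * c\<^sup>2)" if "0 < x" "0 < c" for a x c :: real
      using that by (simp add: power2_eq_square)
    from this[OF mH, of "1 + C"] show ?thesis unfolding e_def mm using C_nonneg by (simp only: add_pos_nonneg zero_less_one)
  qed
  then show "min (1/4) (\<alpha>\<^sup>2 / (512 * (1 + C)\<^sup>2)) * (nrm V3 + nrm V4) \<le> \<Gamma>" using dich(1) by simp
  have "\<alpha>\<^sup>2 * m powr (2*H) / (4 * e) = \<alpha>\<^sup>2 / (16 * (1 + C)) * m powr H"
  proof -
    have "a * (x * x) / (4 * (4 * c * x)) = a / (16 * c) * x" if "0 < x" "0 < c" for a x c :: real
      using that by simp
    from this[OF mH, of "1 + C"] show ?thesis unfolding e_def mm using C_nonneg by (simp only: add_pos_nonneg zero_less_one)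
  qed
  then have "min (4 * (1 + C)) (\<alpha>\<^sup>2 / (16 * (1 + C))) * m powr H = min e (\<alpha>\<^sup>2 * m powr (2*H) / (4 * e))"
    using mH by (simp add: e_def min_mult_distrib_right)
  then show "min (4 * (1 + C)) (\<alpha>\<^sup>2 / (16 * (1 + C))) * m powr H \<le> \<Gamma>" using dich(2) by simp
qed

text \<open>For \<open>p \<ge> b ^ (k + 3)\<close> the integrand only involves increments that lie before the grid point
  \<open>i + p\<close>, hence it is predictable.\<close>

definition integrand :: "nat \<Rightarrow> nat \<Rightarrow> nat \<Rightarrow> 'a \<Rightarrow> real" where
  "integrand k p i \<omega> = sgn (ip (dX k i) (dX k (i + p))) * sgn (dX k i \<omega>)
     + sgn (ip (dX k (i + b ^ (k + 2))) (dX k (i + p))) * sgn (dX k (i + b ^ (k + 2)) \<omega>)"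

definition correlation_sum :: "nat \<Rightarrow> nat \<Rightarrow> nat \<Rightarrow> real" where
  "correlation_sum k p i = \<bar>ip (dX k i) (dX k (i + p))\<bar> / nrm (dX k i)
     + \<bar>ip (dX k (i + b ^ (k + 2))) (dX k (i + p))\<bar> / nrm (dX k (i + b ^ (k + 2)))"

definition transform :: "nat \<Rightarrow> nat \<Rightarrow> 'a \<Rightarrow> real" where
  "transform k p \<omega> = (\<Sum>i\<in>{b ^ k..<2 * b ^ k}. integrand k p i \<omega> * dX k (i + p) \<omega>)"

section \<open>Sign transforms of past increments: moments, predictability and growth\<close>

lemma dX_sq_integrable: "sq_integrable (dX k q)"
  by (intro gauss_span_sq_integrable dX_gauss)

lemma abs_integrand_le: "\<bar>integrand k p i \<omega>\<bar> \<le> 2"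
  by (auto simp: integrand_def sgn_if)

lemma integrand_measurable: "integrand k p i \<in> borel_measurable M"
  unfolding integrand_def[abs_def]
  using dX_sq_integrable[THEN sq_integrable_measurable] by measurable

lemma integrand_dX:
  shows "sq_integrable (\<lambda>\<omega>. integrand k p i \<omega> * dX k (i + p) \<omega>)"
    "nrm (\<lambda>\<omega>. integrand k p i \<omega> * dX k (i + p) \<omega>) \<le> 2 * nrm (dX k (i + p))"
    "expectation (\<lambda>\<omega>. integrand k p i \<omega> * dX k (i + p) \<omega>) = sqrt (2 / pi) * correlation_sum k p i"
proof -
  show "sq_integrable (\<lambda>\<omega>. integrand k p i \<omega> * dX k (i + p) \<omega>)"
    "nrm (\<lambda>\<omega>. integrand k p i \<omega> * dX k (i + p) \<omega>) \<le> 2 * nrm (dX k (i + p))"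
    by (auto intro!: nrm_mult_bounded dX_sq_integrable integrand_measurable abs_integrand_le)
  have int: "integrable M (\<lambda>\<omega>. sgn (ip (dX k q) (dX k (i + p))) * (sgn (dX k q \<omega>) * dX k (i + p) \<omega>))" for q
  proof -
    have [measurable]: "dX k q \<in> borel_measurable M"
      by (rule sq_integrable_measurable[OF dX_sq_integrable])
    have "sq_integrable (\<lambda>\<omega>. sgn (dX k q \<omega>) * dX k (i + p) \<omega>)"
      by (rule nrm_mult_bounded(1)[OF dX_sq_integrable, where c=1]) (auto simp: sgn_if)
    then show ?thesis using sq_integrable_integrable by auto
  qed
  have "expectation (\<lambda>\<omega>. integrand k p i \<omega> * dX k (i + p) \<omega>) =
      expectation (\<lambda>\<omega>. sgn (ip (dX k i) (dX k (i + p))) * (sgn (dX k i \<omega>) * dX k (i + p) \<omega>)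
      + sgn (ip (dX k (i + b ^ (k + 2))) (dX k (i + p))) * (sgn (dX k (i + b ^ (k + 2)) \<omega>) * dX k (i + p) \<omega>))"
    by (simp only: integrand_def distrib_right mult.assoc)
  also have "\<dots> = sqrt (2 / pi) * correlation_sum k p i"
    unfolding Bochner_Integration.integral_add[OF int int]
      expectation_sgn_gauss[OF dX_gauss dX_gauss] correlation_sum_def by (rule distrib_left[symmetric])
  finally show "expectation (\<lambda>\<omega>. integrand k p i \<omega> * dX k (i + p) \<omega>) = sqrt (2 / pi) * correlation_sum k p i" .
qed

text \<open>The norm bound is the plain triangle inequality; dependence between the cells is
  ignored. This loses nothing essential, since the means add up without cancellation.\<close>

lemma transform_moments:
  shows "sq_integrable (transform k p)"
    "nrm (transform k p) \<le> 2 * (\<Sum>i\<in>{b ^ k..<2 * b ^ k}. nrm (dX k (i + p)))"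
    "expectation (transform k p) = sqrt (2 / pi) * (\<Sum>i\<in>{b ^ k..<2 * b ^ k}. correlation_sum k p i)"
proof -
  show "sq_integrable (transform k p)"
    unfolding transform_def[abs_def] by (intro sq_integrable_sum integrand_dX)
  have "nrm (transform k p) \<le> (\<Sum>i\<in>{b ^ k..<2 * b ^ k}. nrm (\<lambda>\<omega>. integrand k p i \<omega> * dX k (i + p) \<omega>))"
    unfolding transform_def[abs_def] by (intro nrm_sum_le integrand_dX)
  also have "\<dots> \<le> (\<Sum>i\<in>{b ^ k..<2 * b ^ k}. 2 * nrm (dX k (i + p)))"
    by (intro sum_mono integrand_dX)
  finally show "nrm (transform k p) \<le> 2 * (\<Sum>i\<in>{b ^ k..<2 * b ^ k}. nrm (dX k (i + p)))"
    by (simp add: sum_distrib_left)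
  show "expectation (transform k p) = sqrt (2 / pi) * (\<Sum>i\<in>{b ^ k..<2 * b ^ k}. correlation_sum k p i)"
    unfolding transform_def[abs_def] sum_distrib_left integrand_dX(3)[symmetric]
    by (intro Bochner_Integration.integral_sum sq_integrable_integrable integrand_dX)
qed

text \<open>Substituting \<open>q = i + p\<close> attaches the weight to the cell over which one
  integrates. Halving normalises the sum of two signs to an integrand bounded by 1; this is also why
  the tail bound for \<open>transform\<close> is at \<open>2 * K\<close>.\<close>

lemma transform_eq_elementary_integral:
  assumes "p \<le> b ^ (k + 3) + b ^ (k + 2)"
  defines "G \<equiv> \<lambda>q \<omega>. if p + b ^ k \<le> q \<and> q < p + 2 * b ^ k then integrand k p (q - p) \<omega> / 2 else 0"
  shows "(\<Sum>q<b ^ (k + 4). G q \<omega> * dX k q \<omega>) = transform k p \<omega> / 2"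
proof -
  have "p + 2 * b ^ k \<le> b ^ (k + 4)"
  proof -
    have "b ^ (k + 2) \<ge> 2 * (2 * b ^ k)" "b ^ (k + 3) \<ge> 2 * b ^ (k + 2)" "b ^ (k + 4) \<ge> 2 * b ^ (k + 3)"
      using b_ge_2 mult_mono[OF b_ge_2 mult_mono[OF b_ge_2 order_refl[of "b ^ k"]]]
      by (simp_all add: power_add power2_eq_square power3_eq_cube power4_eq_xxxx)
    then show ?thesis using assms(1) by linarith
  qed
  then have "(\<Sum>q<b ^ (k + 4). G q \<omega> * dX k q \<omega>) = (\<Sum>q\<in>{b ^ k + p..<2 * b ^ k + p}. G q \<omega> * dX k q \<omega>)"
    by (intro sum.mono_neutral_right) (auto simp: G_def)
  also have "\<dots> = (\<Sum>i\<in>{b ^ k..<2 * b ^ k}. G (i + p) \<omega> * dX k (i + p) \<omega>)"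
    by (rule sum.shift_bounds_nat_ivl)
  also have "\<dots> = (\<Sum>i\<in>{b ^ k..<2 * b ^ k}. integrand k p i \<omega> * dX k (i + p) \<omega> / 2)"
    by (rule sum.cong) (auto simp: G_def)
  finally show ?thesis by (simp add: transform_def sum_divide_distrib)
qed

lemma transform_tail_prob:
  assumes F: "filtration_of M F" and X: "adapted01 F X"
    and K: "0 < K" "\<And>n G. 0 < n \<Longrightarrow> (\<And>q. q < n \<Longrightarrow> G q \<in> borel_measurable (F (real q / real n))) \<Longrightarrow>
       (\<And>q \<omega>. q < n \<Longrightarrow> \<omega> \<in> space M \<Longrightarrow> \<bar>G q \<omega>\<bar> \<le> 1) \<Longrightarrow>
       prob {\<omega> \<in> space M. K \<le> \<bar>\<Sum>q<n. G q \<omega> * (X (real (Suc q) / real n) \<omega> - X (real q / real n) \<omega>)\<bar>} \<le> \<epsilon>"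
    and p: "b ^ (k + 3) \<le> p" "p \<le> b ^ (k + 3) + b ^ (k + 2)"
  shows "prob {\<omega> \<in> space M. 2 * K \<le> \<bar>transform k p \<omega>\<bar>} \<le> \<epsilon>"
proof -
  define n where "n = b ^ (k + 4)"
  have n0: "0 < n" using b_ge_2 by (simp add: n_def)
  define G where "G q \<omega> = (if p + b ^ k \<le> q \<and> q < p + 2 * b ^ k then integrand k p (q - p) \<omega> / 2 else 0)" for q \<omega>
  have Xm: "X (real r / real n) \<in> borel_measurable (F (real q / real n))" if "r \<le> q" "q \<le> n" for r q
  proof -
    have "X (real r / real n) \<in> borel_measurable (F (real r / real n))"
      using X that n0 unfolding adapted01_def by (auto simp: divide_le_eq)
    moreover have "subalgebra (F (real q / real n)) (F (real r / real n))"
      using F that n0 by (auto simp: subalgebra_def filtration_of_def filtration_def divide_right_mono)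
    ultimately show ?thesis using measurable_from_subalg by blast
  qed
  \<comment> \<open>The later of the two past increments ends at grid index
    \<open>Suc (i + b ^ (k + 2))\<close>, so it is known at index \<open>i + p\<close> as soon as
    \<open>p\<close> exceeds \<open>b ^ (k + 2)\<close>.\<close>
  have "b ^ (k + 3) \<ge> 2 * b ^ (k + 2)" "0 < b ^ (k + 2)"
    using b_ge_2 by (simp_all add: power_add power2_eq_square power3_eq_cube)
  then have past: "Suc (i + b ^ (k + 2)) \<le> i + p" for i using p(1) by linarith
  have dXm: "dX k r \<in> borel_measurable (F (real q / real n))" if "Suc r \<le> q" "q \<le> n" for r q
    unfolding dX_def[abs_def] n_def[symmetric] using that by (intro borel_measurable_diff Xm) auto
  have Gm: "G q \<in> borel_measurable (F (real q / real n))" if "q < n" for q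
  proof (cases "p + b ^ k \<le> q \<and> q < p + 2 * b ^ k")
    case True
    define i where "i = q - p"
    have "Suc (i + b ^ (k + 2)) \<le> q" using past[of i] True by (simp add: i_def)
    then have [measurable]: "dX k i \<in> borel_measurable (F (real q / real n))"
      "dX k (i + b ^ (k + 2)) \<in> borel_measurable (F (real q / real n))"
      using that by (auto intro!: dXm)
    have Gq: "G q = (\<lambda>\<omega>. integrand k p i \<omega> / 2)" using True by (auto simp: G_def i_def fun_eq_iff)
    show ?thesis unfolding Gq integrand_def by measurable
  next
    case False
    then have "G q = (\<lambda>\<omega>. 0)" by (auto simp: G_def fun_eq_iff)
    then show ?thesis by simp
  qed
  have G1: "\<bar>G q \<omega>\<bar> \<le> 1" for q \<omega> using abs_integrand_le[of k p "q - p" \<omega>] by (simp add: G_def)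
  have eq: "(\<Sum>q<n. G q \<omega> * (X (real (Suc q) / real n) \<omega> - X (real q / real n) \<omega>)) = transform k p \<omega> / 2" for \<omega>
    using transform_eq_elementary_integral[OF p(2), of \<omega>] by (simp add: G_def n_def dX_def)
  have "prob {\<omega> \<in> space M. K \<le> \<bar>transform k p \<omega> / 2\<bar>} \<le> \<epsilon>"
    using K(2)[OF n0 Gm G1, unfolded eq] .
  moreover have "{\<omega> \<in> space M. K \<le> \<bar>transform k p \<omega> / 2\<bar>} = {\<omega> \<in> space M. 2 * K \<le> \<bar>transform k p \<omega>\<bar>}"
    by auto
  ultimately show ?thesis by simp
qed

text \<open>There are \<open>b ^ k\<close> cells, each contributing a mean of order
  \<open>m powr H\<close>; the product grows like \<open>b powr ((1 - H) * k)\<close>.\<close>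

lemma mesh_power_diverges:
  assumes "0 < c"
  shows "filterlim (\<lambda>k. c * (real b ^ k * (1 / real b ^ (k + 3)) powr H)) at_top sequentially"
proof -
  have b0: "0 < real b" using b_ge_2 by simp
  define a where "a = real b powr (1 - H)"
  have "1 < a" unfolding a_def using b_ge_2 H_less_1 by (intro gr_one_powr) auto
  have "real b ^ k * (1 / real b ^ (k + 3)) powr H = a ^ k * real b powr (- 3 * H)" for k
  proof -
    have "(1 / real b ^ (k + 3)) powr H = real b powr (- real (k + 3) * H)"
      using b0 by (simp add: powr_realpow[symmetric] powr_minus_divide[symmetric] powr_powr del: of_nat_add)
    moreover have "real b ^ k = real b powr real k" using b0 by (simp add: powr_realpow)
    moreover have "a ^ k = real b powr ((1 - H) * real k)"
      unfolding a_def using b0 by (simp add: powr_powr powr_realpow[symmetric])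
    ultimately show ?thesis by (simp add: powr_add[symmetric] algebra_simps)
  qed
  moreover have "filterlim (\<lambda>k. (c * real b powr (- 3 * H)) * a ^ k) at_top sequentially"
    using \<open>1 < a\<close> assms b0 filterlim_realpow_sequentially_gt1[of a]
    by (intro filterlim_tendsto_pos_mult_at_top[OF tendsto_const])
       (auto intro: filterlim_at_infinity_imp_filterlim_at_top)
  ultimately show ?thesis by (simp add: mult_ac)
qed

theorem not_semimartingale:
  assumes F: "filtration_of M F"
  shows "\<not> semimartingale01 M F X"
proof
  assume semi: "semimartingale01 M F X"
  define c0 where "c0 = min (1/4) (\<alpha>\<^sup>2 / (512 * (1 + C)\<^sup>2))"
  define c1 where "c1 = min (4 * (1 + C)) (\<alpha>\<^sup>2 / (16 * (1 + C)))"
  define z where "z = sqrt (2 / pi)"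
  have pos: "0 < c0" "0 < c1" "0 < z" using \<alpha>_pos C_nonneg by (auto simp: c0_def c1_def z_def)
  \<comment> \<open>The ratio of norm to mean: 2 bounds the integrand, \<open>c0\<close> compares
    norms with correlations, and \<open>z\<close> is the Gaussian factor in the means. With
    \<open>\<epsilon> = 1 / (16 * R\<^sup>2)\<close>, two tail probabilities stay below the lower
    bound \<open>1 / (4 * R\<^sup>2)\<close>.\<close>
  define R where "R = 2 / (c0 * z)"
  have R: "0 < R" using pos by (simp add: R_def)
  define \<epsilon> where "\<epsilon> = 1 / (16 * R\<^sup>2)"
  have \<epsilon>: "0 < \<epsilon>" using R by (simp add: \<epsilon>_def)
  obtain K where K: "0 < K"
    "\<And>n G. 0 < n \<Longrightarrow> (\<And>q. q < n \<Longrightarrow> G q \<in> borel_measurable (F (real q / real n))) \<Longrightarrow>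
       (\<And>q \<omega>. q < n \<Longrightarrow> \<omega> \<in> space M \<Longrightarrow> \<bar>G q \<omega>\<bar> \<le> 1) \<Longrightarrow>
       prob {\<omega> \<in> space M. K \<le> \<bar>\<Sum>q<n. G q \<omega> * (X (real (Suc q) / real n) \<omega> - X (real q / real n) \<omega>)\<bar>} \<le> \<epsilon>"
    using semimartingale_integrals_bounded_in_prob[OF F semi \<epsilon>] by blast
  have ad: "adapted01 F X" using semi by (simp add: semimartingale01_def)
  define m where "m k = 1 / real b ^ (k + 3)" for k
  have "filterlim m (at_right 0) sequentially"
  proof -
    have "filterlim (\<lambda>k. inverse (real b ^ (k + 3))) (at_right 0) sequentially"
      using b_ge_2 filterlim_realpow_sequentially_gt1[of "real b"]
      by (intro filterlim_compose[OF filterlim_inverse_at_right_top]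
          filterlim_compose[OF _ filterlim_add_const_nat_at_top, where g="\<lambda>k. real b ^ k"])
         (auto intro: filterlim_at_infinity_imp_filterlim_at_top)
    then show ?thesis by (simp add: m_def[abs_def] divide_inverse)
  qed
  moreover have "eventually (\<lambda>m. cov_error (1 / (2 * real b ^ 4)) m \<le> \<alpha>\<^sup>2 / 16 * m powr (2*H)) (at_right 0)"
    using \<alpha>_pos b_ge_2 by (intro cov_error_small) auto
  moreover have "eventually (\<lambda>m. m \<le> 1 / (2 * real b ^ 4)) (at_right 0)"
    using b_ge_2 by (intro eventually_at_rightI[of 0 "1 / (2 * real b ^ 4)"]) auto
  ultimately have
    "eventually (\<lambda>k. cov_error (1 / (2 * real b ^ 4)) (m k) \<le> \<alpha>\<^sup>2 / 16 * m k powr (2*H)) sequentially"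
    "eventually (\<lambda>k. m k \<le> 1 / (2 * real b ^ 4)) sequentially"
    by (auto simp: filterlim_iff)
  moreover have "eventually (\<lambda>k. 8 * K \<le> z * c1 * (real b ^ k * m k powr H)) sequentially"
    using mesh_power_diverges[of "z * c1"] pos unfolding m_def filterlim_at_top by auto
  ultimately have "eventually (\<lambda>k. cov_error (1 / (2 * real b ^ 4)) (m k) \<le> \<alpha>\<^sup>2 / 16 * m k powr (2*H)
      \<and> m k \<le> 1 / (2 * real b ^ 4) \<and> 8 * K \<le> z * c1 * (real b ^ k * m k powr H)) sequentially"
    by (intro eventually_conj)
  then obtain k where "cov_error (1 / (2 * real b ^ 4)) (m k) \<le> \<alpha>\<^sup>2 / 16 * m k powr (2*H)
      \<and> m k \<le> 1 / (2 * real b ^ 4) \<and> 8 * K \<le> z * c1 * (real b ^ k * m k powr H)"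
    using eventually_happens'[OF sequentially_bot] by blast
  then have k: "16 * cov_error (1 / (2 * real b ^ 4)) (m k) \<le> \<alpha>\<^sup>2 * m k powr (2*H)"
      "m k \<le> 1 / (2 * real b ^ 4)" "8 * K \<le> z * c1 * (real b ^ k * m k powr H)"
    by auto
  define I where "I = {b ^ k..<2 * b ^ k}"
  define p q where "p = b ^ (k + 3)" and "q = b ^ (k + 3) + b ^ (k + 2)"
  define \<Gamma> where "\<Gamma> i = correlation_sum k p i + correlation_sum k q i" for i
  have \<Gamma>: "c0 * (nrm (dX k (i + p)) + nrm (dX k (i + q))) \<le> \<Gamma> i" "c1 * m k powr H \<le> \<Gamma> i" if "i \<in> I" for i
    using dX_correlations[of k i "m k" _ _ _ _ "\<Gamma> i", OF _ _ _ k(2,1) refl refl refl refl] that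
    unfolding c0_def c1_def by (auto simp: I_def m_def \<Gamma>_def correlation_sum_def p_def q_def)
  \<comment> \<open>Whether \<open>V3\<close> or \<open>V4\<close> carries the correlation may vary
    with the cell, so both transforms are added. If
    \<open>S \<omega> \<ge> \<mu> / 2 \<ge> 4 * K\<close>, one of the two is at least
    \<open>2 * K\<close>.\<close>
  define S where "S \<omega> = transform k p \<omega> + transform k q \<omega>" for \<omega>
  define \<mu> where "\<mu> = z * (\<Sum>i\<in>I. \<Gamma> i)"
  note tr = transform_moments[of k, folded I_def]
  have S2: "sq_integrable S" unfolding S_def[abs_def] by (intro sq_integrable_add tr)
  have ES: "expectation S = \<mu>"
    unfolding S_def \<mu>_def \<Gamma>_def
    using tr(3)[of p] tr(3)[of q] sq_integrable_integrable[OF tr(1)[of p]] sq_integrable_integrable[OF tr(1)[of q]]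
    by (simp add: sum.distrib distrib_left z_def)
  have "z * (c1 * (real b ^ k * m k powr H)) = z * (\<Sum>i\<in>I. c1 * m k powr H)"
    by (simp add: I_def)
  also have "\<dots> \<le> \<mu>"
    unfolding \<mu>_def using pos \<Gamma>(2) by (intro mult_left_mono sum_mono) auto
  finally have \<mu>K: "8 * K \<le> \<mu>" using k(3) by (simp add: mult.assoc)
  have "nrm S \<le> nrm (transform k p) + nrm (transform k q)"
    unfolding S_def[abs_def] by (intro nrm_add_le tr)
  also have "\<dots> \<le> 2 * (\<Sum>i\<in>I. nrm (dX k (i + p)) + nrm (dX k (i + q)))"
    using tr(2)[of p] tr(2)[of q] by (simp add: sum.distrib)
  also have "\<dots> \<le> 2 * (\<Sum>i\<in>I. \<Gamma> i / c0)"
    using \<Gamma>(1) pos by (intro mult_left_mono sum_mono) (auto simp: field_simps)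
  also have "\<dots> = R * \<mu>"
    using pos by (simp add: R_def \<mu>_def sum_divide_distrib[symmetric])
  finally have "1 / (4 * R\<^sup>2) \<le> prob {\<omega> \<in> space M. \<mu> / 2 \<le> S \<omega>}"
    using paley_zygmund[OF S2 _ _ _ R, of \<mu>] ES \<mu>K K(1) by simp
  also have "\<dots> \<le> prob ({\<omega> \<in> space M. 2 * K \<le> \<bar>transform k p \<omega>\<bar>} \<union> {\<omega> \<in> space M. 2 * K \<le> \<bar>transform k q \<omega>\<bar>})"
  proof (rule finite_measure_mono)
    show "{\<omega> \<in> space M. \<mu> / 2 \<le> S \<omega>} \<subseteq> {\<omega> \<in> space M. 2 * K \<le> \<bar>transform k p \<omega>\<bar>} \<union> {\<omega> \<in> space M. 2 * K \<le> \<bar>transform k q \<omega>\<bar>}"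
      using \<mu>K by (auto simp: S_def)
    have [measurable]: "transform k p \<in> borel_measurable M" "transform k q \<in> borel_measurable M"
      by (auto intro: sq_integrable_measurable tr)
    show "{\<omega> \<in> space M. 2 * K \<le> \<bar>transform k p \<omega>\<bar>} \<union> {\<omega> \<in> space M. 2 * K \<le> \<bar>transform k q \<omega>\<bar>} \<in> events"
      by measurable
  qed
  also have "\<dots> \<le> prob {\<omega> \<in> space M. 2 * K \<le> \<bar>transform k p \<omega>\<bar>} + prob {\<omega> \<in> space M. 2 * K \<le> \<bar>transform k q \<omega>\<bar>}"
    by (rule measure_Un_le)
       (use tr(1)[THEN sq_integrable_measurable] in measurable)
  also have "\<dots> \<le> \<epsilon> + \<epsilon>"
    by (intro add_mono transform_tail_prob[OF F ad K]) (auto simp: p_def q_def)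
  finally show False using R by (simp add: \<epsilon>_def field_simps)
qed

end

theorem theorem2p5:
  fixes M :: "'a measure" and W :: "real \<Rightarrow> 'a \<Rightarrow> real" and \<kappa> :: "real \<Rightarrow> real"
    and H \<alpha> \<tau> :: real and b :: nat
  assumes "prob_space M"
    and "0 < H" "H < 1"
    and "fbm M H W"
    and "0 < \<alpha>" "\<alpha> < 1"
    and "2 \<le> b"
    and "\<kappa> 0 = 0" "\<kappa> 1 = 1" "\<kappa> ` {0..1} \<subseteq> {0..1}"
    and "H < \<tau>" "\<tau> \<le> 1"
    and "\<exists>C. \<forall>s\<in>{0..1}. \<forall>t\<in>{0..1}. \<bar>\<kappa> s - \<kappa> t\<bar> \<le> C * \<bar>s - t\<bar> powr \<tau>"
  shows "\<not> (\<exists>F. filtration_of M F \<and> semimartingale01 M F (wwbridge W \<kappa> \<alpha> b))"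
proof -
  interpret prob_space M by fact
  obtain C where C: "\<bar>\<kappa> s - \<kappa> t\<bar> \<le> C * \<bar>s - t\<bar> powr \<tau>" if "s \<in> {0..1}" "t \<in> {0..1}" for s t
    using assms(13) by blast
  have "\<bar>\<kappa> s - \<kappa> t\<bar> \<le> \<bar>C\<bar> * \<bar>s - t\<bar> powr \<tau>" if "0 \<le> s" "s \<le> 1" "0 \<le> t" "t \<le> 1" for s t
    by (rule order_trans[OF C]) (use that in \<open>auto intro!: mult_right_mono\<close>)
  then interpret wiener_weierstrass_bridge M H W \<kappa> \<tau> "\<bar>C\<bar>" \<alpha> b
    by unfold_locales (use assms in auto)
  show ?thesis using not_semimartingale by blast
qed

end
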